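(* Let $\Omega:=\{(x,y)\in\mathbb{R}^m\times\mathbb{R}^m \mid x\in\mathcal{K},\ y\in\mathcal{K},\ x^Ty=0\}$, where $\mathcal{K}$ is the $m$-dimensional second-order cone, and let $(x,y)\in\Omega$. Then the limiting normal cone $N_\Omega(x,y)$ is given as follows (with $(u,v)$ ranging over $\mathbb{R}^m\times\mathbb{R}^m$). (1) In the following three cases $N_\Omega(x,y)=\widehat{N}_\Omega(x,y)$, and this cone equals $$ \begin{cases} \{(u,v)\mid u\in\mathbb{R}^m,\ v=0\} & \text{if } x=0,\ y\in\operatorname{int}\mathcal{K};\\ \{(u,v)\mid u=0,\ v\in\mathbb{R}^m\} & \text{if } x\in\operatorname{int}\mathcal{K},\ y=0;\\ \{(u,v)\mid u\perp x,\ v\perp y,\ x_1\hat{u}+y_1v\in\mathbb{R}x\} & \text{if } x,y\in\operatorname{bd}\mathcal{K}\setminus\{0\}. \end{cases} $$ (2) If $x=0$ and $y\in\operatorname{bd}\mathcal{K}\setminus\{0\}$, then $$N_\Omega(x,y)=\{(u,v)\mid u\in\mathbb{R}^m,\ v=0\ \text{ or }\ u\perp\hat{y},\ v\in\mathbb{R}\hat{y}\ \text{ or }\ \langle u,\hat{y}\rangle\le 0,\ v\in\mathbb{R}_-\hat{y}\}.$$ (3) If $x\in\operatorname{bd}\mathcal{K}\setminus\{0\}$ and $y=0$, then $$N_\Omega(x,y)=\{(u,v)\mid u=0,\ v\in\mathbb{R}^m\ \text{ or }\ u\in\mathbb{R}\hat{x},\ v\perp\hat{x}\ \text{ or }\ u\in\mathbb{R}_-\hat{x},\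 \langle v,\hat{x}\rangle\le 0\}.$$ (4) If $x=y=0$, then $N_\Omega(x,y)$ is the set of all $(u,v)$ satisfying at least one of the following: (a) $u\in-\mathcal{K}$ and $v\in-\mathcal{K}$; (b) $u\in\mathbb{R}^m$ and $v=0$; (c) $u=0$ and $v\in\mathbb{R}^m$; (d) $u\in\mathbb{R}_-\xi$ and $v\in\xi^\circ$ for some $\xi\in C$; (e) $u\in\xi^\circ$ and $v\in\mathbb{R}_-\xi$ for some $\xi\in C$; (f) $u\perp\xi$, $v\perp\hat{\xi}$ and $\alpha\hat{u}+(1-\alpha)v\in\mathbb{R}\xi$ for some $\alpha\in[0,1]$ and some $\xi\in C$, where $C:=\{(1,w)\mid w\in\mathbb{R}^{m-1},\ \|w\|=1\}$.
   Context: Vectors of $\mathbb{R}^m$ are written $x=(x_1,x_2)\in\mathbb{R}\times\mathbb{R}^{m-1}$; $\|\cdot\|$ is the Euclidean norm. The second-order cone is $\mathcal{K}:=\{(x_1,x_2)\in\mathbb{R}\times\mathbb{R}^{m-1}\mid x_1\ge\|x_2\|\}$, with $\operatorname{int}\mathcal{K}=\{x\mid x_1>\|x_2\|\}$ and $\operatorname{bd}\mathcal{K}=\{x\mid x_1=\|x_2\|\}$. For $x=(x_1,x_2)$, the reflection is $\hat{x}:=(x_1,-x_2)$. For a vector $x$, $\mathbb{R}x:=\{tx\mid t\in\mathbb{R}\}$ and $\mathbb{R}_-x:=\{tx\mid t\le 0\}$. For a vector $v$, $v^\circ:=\{x\mid x^Tv\le 0\}$. For $S\subset\mathbb{R}^n$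 and $x^*\in\operatorname{cl}S$: - the proximal normal cone is $N^\pi_S(x^* ):=\{v\in\mathbb{R}^n\mid \exists M>0 \text{ such that } \langle v,x-x^*\rangle\le M\|x-x^*\|^2\ \ \forall x\in S\}$; - the regular (Fréchet) normal cone is $\widehat{N}_S(x^* ):=\{v\in\mathbb{R}^n\mid \langle v,x-x^*\rangle\le o(\|x-x^*\|)\ \ \forall x\in S\}$; - the limiting (Mordukhovich) normal cone is $N_S(x^* ):=\{\lim_{i\to\infty}\zeta_i\mid \zeta_i\in N^\pi_S(x_i),\ x_i\to x^*,\ x_i\in S\}=\{\lim_{i\to\infty}\zeta_i\mid \zeta_i\in\widehat{N}_S(x_i),\ x_i\to x^*,\ x_i\in S\}$ (the two descriptions are well known to agree). *)

theory Defs
  imports "HOL-Analysis.Analysis" "HOL-Library.Landau_Symbols"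
begin

text \<open>
  Coordinates of \<open>\<real>\<^sup>m\<close> are indexed by a finite linearly ordered type, so that there is a first
  coordinate \<open>x\<^sub>1\<close>.  The block \<open>x\<^sub>2 \<in> \<real>\<^bsup>m-1\<^esup>\<close> is represented by the vector of \<open>\<real>\<^sup>m\<close> that agrees with
  \<open>x\<close> except for a zero first coordinate; this is an isometric embedding of \<open>\<real>\<^bsup>m-1\<^esup>\<close>.  In contrast
  to a product type \<open>\<real> \<times> \<real>\<^sup>n\<close>, where \<open>n\<close> cannot be zero, it also covers \<open>m = 1\<close>.
\<close>

definition coord1 :: "real ^ 'm::{finite,linorder} \<Rightarrow> real" where
  "coord1 x = x $ Min UNIV"

definition coord2 :: "real ^ 'm::{finite,linorder} \<Rightarrow> real ^ 'm::{finite,linorder}" where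
  "coord2 x = (\<chi> i. if i = Min UNIV then 0 else x $ i)"

definition reflect :: "real ^ 'm::{finite,linorder} \<Rightarrow> real ^ 'm::{finite,linorder}" where
  "reflect x = (\<chi> i. if i = Min UNIV then x $ i else - (x $ i))"

definition soc :: "(real ^ 'm::{finite,linorder}) set" where
  "soc = {x. coord1 x \<ge> norm (coord2 x)}"

definition soc_compl :: "((real ^ 'm::{finite,linorder}) \<times> (real ^ 'm::{finite,linorder})) set" where
  "soc_compl = {(x, y). x \<in> soc \<and> y \<in> soc \<and> x \<bullet> y = 0}"

text \<open>The set of all \<open>(1, w)\<close> with \<open>\<parallel>w\<parallel> = 1\<close>; it is empty if \<open>m = 1\<close>.\<close>

definition soc_directions :: "(real ^ 'm::{finite,linorder}) set" where
  "soc_directions = {\<xi>. coord1 \<xi> = 1 \<and> norm (coord2 \<xi>) = 1}"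

definition line_of :: "'a::real_vector \<Rightarrow> 'a set" where
  "line_of x = {t *\<^sub>R x | t. True}"

definition neg_ray :: "'a::real_vector \<Rightarrow> 'a set" where
  "neg_ray x = {t *\<^sub>R x | t. t \<le> 0}"

definition polar_of :: "'a::real_inner \<Rightarrow> 'a set" where
  "polar_of v = {x. x \<bullet> v \<le> 0}"

text \<open>The normal cones are meant for base points \<open>z\<close> in the closure of \<open>S\<close>.\<close>

definition proximal_normal_cone :: "'a::euclidean_space set \<Rightarrow> 'a \<Rightarrow> 'a set" where
  "proximal_normal_cone S z =
     {v. \<exists>M>0. \<forall>x\<in>S. v \<bullet> (x - z) \<le> M * (norm (x - z))\<^sup>2}"

definition regular_normal_cone :: "'a::euclidean_space set \<Rightarrow> 'a \<Rightarrow> 'a set" where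
  "regular_normal_cone S z =
     {v. \<exists>r :: real \<Rightarrow> real. r \<in> o[at_right 0](\<lambda>t. t) \<and> (\<forall>x\<in>S. v \<bullet> (x - z) \<le> r (norm (x - z)))}"

definition limiting_normal_cone :: "'a::euclidean_space set \<Rightarrow> 'a \<Rightarrow> 'a set" where
  "limiting_normal_cone S z =
     {v. \<exists>\<zeta> x. (\<forall>i::nat. x i \<in> S \<and> \<zeta> i \<in> proximal_normal_cone S (x i)) \<and>
               x \<longlonglongrightarrow> z \<and> \<zeta> \<longlonglongrightarrow> v}"

end

theory Submission
  imports Defs
begin

text \<open>
  Write \<open>\<Omega>\<close> for the complementarity set \<open>soc_compl\<close> and \<open>\<K>\<close> for the cone \<open>soc\<close>.  Orthogonality forces
  equality in the Cauchy--Schwarz inequality, which amounts to the identity \<open>x\<^sub>1 y = y\<^sub>1 reflect x\<close> on all of \<open>\<Omega>\<close>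
  (\<open>soc_compl_parallel\<close>).  It splits \<open>\<Omega>\<close> into the origin, the points \<open>(0, y)\<close> with \<open>y\<close> in the interior
  or on the nonzero boundary of \<open>\<K>\<close>, their mirror images under the exchange of the two arguments,
  and the points with both components nonzero; near the latter \<open>\<Omega>\<close> is a smooth manifold, because
  \<open>x\<close> moves on the nonzero boundary and \<open>y\<close> is a positive multiple of \<open>reflect x\<close>.

  On each stratum outside the origin the regular and the proximal normals coincide and can be
  computed.  Testing a regular normal with curves inside \<open>\<Omega>\<close> yields the necessary conditions
  (\<open>regular_normal_apex_interior\<close>, \<open>regular_normal_apex_frontier\<close>, \<open>regular_normal_smooth\<close>).
  Conversely, for a vector that satisfies them, the identity turns the first-order part of
  \<open>w \<bullet> (p - z)\<close> into products of two increments or into terms of the right sign, which gives the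
  quadratic bound that defines a proximal normal (\<open>proximal_normal_apex_frontier\<close>,
  \<open>proximal_normal_smooth\<close>); if \<open>y\<close> is interior, all points of \<open>\<Omega>\<close> near \<open>(0, y)\<close> have first component
  zero and the bound only concerns points far away (\<open>proximal_normal_apex_interior\<close>).

  The limiting normals at a point collect the normals of all strata that accumulate there.  For the
  upper bound, the conditions of these strata are rewritten as closed conditions on the pair of base
  point and normal, so that they survive the passage to the limit (\<open>limiting_normal_closed_graph\<close>);
  at the origin the conditions contain an existential quantifier over \<open>\<xi>\<close> and \<open>\<alpha>\<close>, and closedness
  comes from compactness of the parameter set.  For the lower bound, every claimed normal is the
  limit of proximal normals along an explicit curve of base points.  The exchange of the arguments
  maps \<open>\<Omega>\<close> to itself and reduces the points \<open>(x, 0)\<close> to the points \<open>(0, y)\<close>.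
\<close>

section \<open>Normal cones of arbitrary sets\<close>

lemma proximal_subset_regular: "proximal_normal_cone S z \<subseteq> regular_normal_cone S z"
proof
  fix w assume "w \<in> proximal_normal_cone S z"
  then obtain M where M: "\<forall>x\<in>S. w \<bullet> (x - z) \<le> M * (norm (x - z))\<^sup>2"
    by (auto simp: proximal_normal_cone_def)
  have "((\<lambda>t::real. M * t) \<longlongrightarrow> M * 0) (at_right 0)"
    by (intro tendsto_intros)
  moreover have "(\<lambda>t::real. M * t\<^sup>2 / t) = (\<lambda>t. M * t)"
    by (auto simp: power2_eq_square)
  ultimately have "((\<lambda>t::real. M * t\<^sup>2 / t) \<longlongrightarrow> 0) (at_right 0)"
    by simp
  then have "(\<lambda>t. M * t\<^sup>2) \<in> o[at_right 0](\<lambda>t::real. t)"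
    by (intro smalloI_tendsto) (auto simp: eventually_at_right_less eventually_at_filter)
  with M show "w \<in> regular_normal_cone S z"
    unfolding regular_normal_cone_def by (intro CollectI exI[of _ "\<lambda>t. M * t\<^sup>2"]) auto
qed

lemma regular_normalD:
  assumes "w \<in> regular_normal_cone S z" "0 < e"
  obtains \<delta> where "0 < \<delta>" "\<And>p. p \<in> S \<Longrightarrow> norm (p - z) < \<delta> \<Longrightarrow> w \<bullet> (p - z) \<le> e * norm (p - z)"
proof -
  from assms(1) obtain r where r: "r \<in> o[at_right 0](\<lambda>t::real. t)"
      "\<And>p. p \<in> S \<Longrightarrow> w \<bullet> (p - z) \<le> r (norm (p - z))"
    by (auto simp: regular_normal_cone_def)
  from landau_o.smallD[OF r(1) assms(2)] obtain \<delta> where d: "\<delta> > 0"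
      "\<And>t. 0 < t \<Longrightarrow> t < \<delta> \<Longrightarrow> \<bar>r t\<bar> \<le> e * \<bar>t\<bar>"
    by (auto simp: eventually_at_right[OF zero_less_one])
  show thesis
  proof (rule that[OF d(1)])
    fix p assume p: "p \<in> S" "norm (p - z) < \<delta>"
    show "w \<bullet> (p - z) \<le> e * norm (p - z)"
    proof (cases "p = z")
      case False
      then have "\<bar>r (norm (p - z))\<bar> \<le> e * \<bar>norm (p - z)\<bar>" using p d(2) by simp
      then show ?thesis using r(2)[OF p(1)] by simp
    qed simp
  qed
qed

text \<open>A direction may be tested as soon as \<open>S\<close> contains points within \<open>O(t\<^sup>2)\<close> of \<open>z + t d\<close>.  In this form
  the test applies to curved arcs without computing their derivatives.\<close>

lemma regular_normal_curve:
  assumes w: "w \<in> regular_normal_cone S z"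
    and curve: "\<forall>\<^sub>F t in at_right 0. \<exists>p\<in>S. norm (p - z - t *\<^sub>R d) \<le> C * t\<^sup>2"
  shows "w \<bullet> d \<le> 0"
proof -
  have *: "w \<bullet> d \<le> e * norm d" if e: "e > 0" for e
  proof -
    obtain \<delta> where \<delta>: "0 < \<delta>"
      "\<And>p. p \<in> S \<Longrightarrow> norm (p - z) < \<delta> \<Longrightarrow> w \<bullet> (p - z) \<le> e * norm (p - z)"
      using regular_normalD[OF w e] by blast
    have "((\<lambda>t. t * norm d + C * t\<^sup>2) \<longlongrightarrow> 0 * norm d + C * 0\<^sup>2) (at_right 0)"
      by (intro tendsto_intros)
    then have small: "\<forall>\<^sub>F t in at_right 0. t * norm d + C * t\<^sup>2 < \<delta>"
      using \<delta>(1) by (intro order_tendstoD(2)) auto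
    have "\<forall>\<^sub>F t in at_right 0. w \<bullet> d \<le> e * norm d + (e + norm w) * C * t"
      using curve small eventually_at_right_less[of 0]
    proof eventually_elim
      case (elim t)
      then obtain p where p: "p \<in> S" "norm (p - z - t *\<^sub>R d) \<le> C * t\<^sup>2" by blast
      have "norm (p - z) \<le> norm (t *\<^sub>R d) + norm (p - z - t *\<^sub>R d)"
        using norm_triangle_ineq[of "t *\<^sub>R d" "p - z - t *\<^sub>R d"] by simp
      then have np: "norm (p - z) \<le> t * norm d + C * t\<^sup>2" using p(2) elim by simp
      have "w \<bullet> (p - z) \<le> e * norm (p - z)" using \<delta>(2)[OF p(1)] np elim by simp
      also have "\<dots> \<le> e * (t * norm d + C * t\<^sup>2)" using np e by simp
      finally have 1: "w \<bullet> (p - z) \<le> e * (t * norm d + C * t\<^sup>2)" .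
      have "- (w \<bullet> (p - z - t *\<^sub>R d)) \<le> norm w * norm (p - z - t *\<^sub>R d)"
        using Cauchy_Schwarz_ineq2[of w "p - z - t *\<^sub>R d"] by linarith
      also have "\<dots> \<le> norm w * (C * t\<^sup>2)" using p(2) by (simp add: mult_left_mono)
      finally have "t * (w \<bullet> d) \<le> w \<bullet> (p - z) + norm w * (C * t\<^sup>2)"
        by (simp add: inner_diff_right)
      with 1 have "t * (w \<bullet> d) \<le> t * (e * norm d + (e + norm w) * C * t)"
        by (simp add: algebra_simps power2_eq_square)
      then show ?case using elim by simp
    qed
    moreover have "((\<lambda>t. e * norm d + (e + norm w) * C * t)
        \<longlongrightarrow> e * norm d + (e + norm w) * C * 0) (at_right 0)"
      by (intro tendsto_intros)
    ultimately show ?thesis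
      using tendsto_lowerbound[of _ _ "at_right (0::real)"] by fastforce
  qed
  show ?thesis
  proof (rule ccontr)
    assume "\<not> w \<bullet> d \<le> 0"
    \<comment> \<open>the tolerance \<open>e\<close> is chosen so small that \<open>e * norm d\<close> stays below \<open>w \<bullet> d\<close>\<close>
    moreover have "w \<bullet> d / (2 * (norm d + 1)) * norm d < w \<bullet> d" if "w \<bullet> d > 0"
    proof -
      have "(w \<bullet> d) * norm d < (w \<bullet> d) * (2 * (norm d + 1))"
        using that by (intro mult_strict_left_mono) (auto intro: le_less_trans[of _ "norm d"] simp: add_pos_nonneg)
      then show ?thesis
        by (simp add: field_simps add_pos_nonneg)
    qed
    moreover have "w \<bullet> d / (2 * (norm d + 1)) > 0" if "w \<bullet> d > 0"
      using that by (intro divide_pos_pos) (auto simp: add_nonneg_pos)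
    ultimately show False using *[of "w \<bullet> d / (2 * (norm d + 1))"] by force
  qed
qed

lemma regular_normal_segment:
  assumes "w \<in> regular_normal_cone S z" "0 < \<delta>"
    and "\<And>t. 0 < t \<Longrightarrow> t < \<delta> \<Longrightarrow> z + t *\<^sub>R d \<in> S"
  shows "w \<bullet> d \<le> 0"
proof (rule regular_normal_curve[OF assms(1)])
  show "\<forall>\<^sub>F t in at_right 0. \<exists>p\<in>S. norm (p - z - t *\<^sub>R d) \<le> 0 * t\<^sup>2"
    unfolding eventually_at_right[OF zero_less_one]
    using assms(2,3) by (intro exI[of _ \<delta>]) (force intro!: bexI)
qed

text \<open>Upper bounds for limiting normals come from here: a closed condition on the pair of base point and
  normal, once established for the proximal normals near \<open>z\<close>, also holds in the limit.\<close>

lemma limiting_normal_closed_graph: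
  assumes w: "w \<in> limiting_normal_cone S z"
    and U: "open U" "z \<in> U" and G: "closed G"
    and sub: "\<And>p q. p \<in> S \<Longrightarrow> p \<in> U \<Longrightarrow> q \<in> proximal_normal_cone S p \<Longrightarrow> (p, q) \<in> G"
  shows "(z, w) \<in> G"
proof -
  obtain q p where qp: "\<And>i::nat. p i \<in> S \<and> q i \<in> proximal_normal_cone S (p i)"
      "p \<longlonglongrightarrow> z" "q \<longlonglongrightarrow> w"
    using w by (auto simp: limiting_normal_cone_def)
  have "\<forall>\<^sub>F i in sequentially. (p i, q i) \<in> G"
    using topological_tendstoD[OF qp(2) U] by eventually_elim (use sub qp(1) in auto)
  then show ?thesis
    by (rule Lim_in_closed_set[OF G _ _ tendsto_Pair[OF qp(2,3)]]) simp
qed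

text \<open>The source of limiting normals: it suffices to exhibit a one-parameter family of base points and
  proximal normals that converges as the parameter decreases to zero.\<close>

lemma limiting_normal_along:
  assumes "\<forall>\<^sub>F t in at_right (0::real). p t \<in> S \<and> q t \<in> proximal_normal_cone S (p t)"
    and p: "(p \<longlongrightarrow> z) (at_right 0)" and q: "(q \<longlongrightarrow> w) (at_right 0)"
  shows "w \<in> limiting_normal_cone S z"
proof -
  obtain \<delta> where \<delta>: "\<delta> > 0"
    "\<And>t. 0 < t \<Longrightarrow> t < \<delta> \<Longrightarrow> p t \<in> S \<and> q t \<in> proximal_normal_cone S (p t)"
    using assms(1) by (auto simp: eventually_at_right[OF zero_less_one])
  define f where "f i = \<delta> / 2 * inverse (real (Suc i))" for i
  have f0: "0 < f i" "f i < \<delta>" for i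
  proof -
    show "0 < f i" using \<delta> by (simp add: f_def)
    have "f i \<le> \<delta> / 2 * 1"
      unfolding f_def using \<delta>(1) by (intro mult_left_mono) (auto simp: field_simps)
    then show "f i < \<delta>" using \<delta>(1) by simp
  qed
  have "f \<longlonglongrightarrow> \<delta> / 2 * 0"
    unfolding f_def by (intro tendsto_intros LIMSEQ_inverse_real_of_nat)
  then have f: "filterlim f (at_right 0) sequentially"
    using f0 by (auto simp: filterlim_at less_imp_neq[THEN not_sym])
  show ?thesis
    unfolding limiting_normal_cone_def
  proof (intro CollectI exI conjI allI)
    show "(\<lambda>i. p (f i)) \<longlonglongrightarrow> z" "(\<lambda>i. q (f i)) \<longlonglongrightarrow> w"
      using filterlim_compose[OF p f] filterlim_compose[OF q f] by auto
  qed (use f0 \<delta>(2) in auto)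
qed

lemma proximal_subset_limiting:
  assumes "z \<in> S" shows "proximal_normal_cone S z \<subseteq> limiting_normal_cone S z"
  using limiting_normal_along[of "\<lambda>_. z" S "\<lambda>_. _" z] assms by auto

section \<open>Geometry of the second-order cone\<close>

definition axis1 :: "real ^ 'm::{finite,linorder}" where
  "axis1 = axis (Min UNIV) 1"

lemma coord1_inner: "coord1 x = x \<bullet> axis1"
  by (simp add: coord1_def axis1_def inner_axis)

lemma axis1_inner_self [simp]: "axis1 \<bullet> axis1 = 1"
  by (simp add: axis1_def inner_axis)

lemma coord2_eq: "coord2 x = x - coord1 x *\<^sub>R axis1"
  by (simp add: vec_eq_iff coord2_def coord1_def axis1_def axis_def)

lemma reflect_eq: "reflect x = (2 * coord1 x) *\<^sub>R axis1 - x"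
  by (simp add: vec_eq_iff reflect_def coord1_def axis1_def axis_def)

lemma coord1_axis1 [simp]: "coord1 axis1 = 1"
  by (simp add: coord1_inner)

lemma coord1_linear [simp]:
  "coord1 0 = 0" "coord1 (x + y) = coord1 x + coord1 y" "coord1 (x - y) = coord1 x - coord1 y"
  "coord1 (- x) = - coord1 x" "coord1 (c *\<^sub>R x) = c * coord1 x"
  by (simp_all add: coord1_def)

lemma coord1_reflect [simp]: "coord1 (reflect x) = coord1 x"
  by (simp add: reflect_eq)

lemma reflect_linear [simp]:
  "reflect 0 = 0" "reflect (x + y) = reflect x + reflect y" "reflect (x - y) = reflect x - reflect y"
  "reflect (- x) = - reflect x" "reflect (c *\<^sub>R x) = c *\<^sub>R reflect x"
  by (simp_all add: reflect_eq algebra_simps)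

lemma reflect_reflect [simp]: "reflect (reflect x) = x"
  by (simp add: reflect_eq)

lemma inner_reflect: "x \<bullet> reflect y = 2 * coord1 x * coord1 y - x \<bullet> y"
  by (simp add: reflect_eq coord1_inner inner_diff_right)

lemma reflect_inner: "reflect x \<bullet> y = x \<bullet> reflect y"
  by (subst inner_commute) (simp add: inner_reflect inner_commute[of x y])

lemma reflect_inner_eq: "reflect x \<bullet> y = 2 * coord1 x * coord1 y - x \<bullet> y"
  by (simp add: reflect_inner inner_reflect)

lemma reflect_inner_reflect [simp]: "reflect x \<bullet> reflect y = x \<bullet> y"
  by (simp add: reflect_inner)

lemma norm_reflect [simp]: "norm (reflect x) = norm x"
  by (simp add: norm_eq_sqrt_inner)

lemma reflect_eq_0 [simp]: "reflect x = 0 \<longleftrightarrow> x = 0"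
  by (metis norm_eq_zero norm_reflect)

lemma tendsto_coord1 [tendsto_intros]:
  "(f \<longlongrightarrow> l) F \<Longrightarrow> ((\<lambda>t. coord1 (f t)) \<longlongrightarrow> coord1 l) F"
  unfolding coord1_inner by (intro tendsto_intros)

lemma tendsto_reflect [tendsto_intros]:
  "(f \<longlongrightarrow> l) F \<Longrightarrow> ((\<lambda>t. reflect (f t)) \<longlongrightarrow> reflect l) F"
  unfolding reflect_eq by (intro tendsto_intros)

lemma continuous_on_coord1 [continuous_intros]:
  "continuous_on A f \<Longrightarrow> continuous_on A (\<lambda>t. coord1 (f t))"
  unfolding coord1_inner by (intro continuous_intros)

lemma continuous_on_reflect [continuous_intros]:
  "continuous_on A f \<Longrightarrow> continuous_on A (\<lambda>t. reflect (f t))"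
  unfolding reflect_eq by (intro continuous_intros)

lemma abs_coord1_le: "\<bar>coord1 x\<bar> \<le> norm x"
  unfolding coord1_def by (rule component_le_norm_cart)

lemma norm_coord2: "(norm (coord2 x))\<^sup>2 = x \<bullet> x - (coord1 x)\<^sup>2"
  unfolding power2_norm_eq_inner
  by (simp add: coord2_eq inner_diff_left inner_diff_right coord1_inner power2_eq_square
      inner_commute)

lemma inner_split: "x \<bullet> y = coord1 x * coord1 y + coord2 x \<bullet> coord2 y"
  by (simp add: coord2_eq inner_diff_left inner_diff_right coord1_inner inner_commute[of axis1 y])

text \<open>The number \<open>x \<bullet> reflect x = x\<^sub>1\<^sup>2 - \<parallel>x\<^sub>2\<parallel>\<^sup>2\<close> is the Lorentz form.  Describing the cone by its sign makes
  membership a polynomial condition, and computations need no splitting into \<open>x\<^sub>1\<close> and \<open>x\<^sub>2\<close>.\<close>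

lemma soc_iff: "x \<in> soc \<longleftrightarrow> 0 \<le> coord1 x \<and> 0 \<le> x \<bullet> reflect x"
proof -
  have "norm (coord2 x) \<le> coord1 x \<longleftrightarrow> 0 \<le> coord1 x \<and> (norm (coord2 x))\<^sup>2 \<le> (coord1 x)\<^sup>2"
    using abs_le_square_iff[of "norm (coord2 x)" "coord1 x"] norm_ge_zero[of "coord2 x"]
    by (auto simp del: norm_ge_zero)
  then show ?thesis
    unfolding soc_def mem_Collect_eq norm_coord2
    by (simp add: inner_reflect power2_eq_square mult.assoc)
qed

lemma soc_reflect [simp]: "reflect x \<in> soc \<longleftrightarrow> x \<in> soc"
  by (simp add: soc_iff reflect_inner)

lemma zero_in_soc [simp]: "0 \<in> soc"
  by (simp add: soc_iff)

lemma axis1_in_soc [simp]: "axis1 \<in> soc"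
  by (simp add: soc_iff inner_reflect)

lemma soc_scaleR: "x \<in> soc \<Longrightarrow> 0 \<le> c \<Longrightarrow> c *\<^sub>R x \<in> soc"
  by (simp add: soc_iff)

lemma soc_add: "x \<in> soc \<Longrightarrow> y \<in> soc \<Longrightarrow> x + y \<in> soc"
proof -
  have "coord2 (x + y) = coord2 x + coord2 y" by (simp add: coord2_eq algebra_simps)
  then show "x \<in> soc \<Longrightarrow> y \<in> soc \<Longrightarrow> x + y \<in> soc"
    using norm_triangle_ineq[of "coord2 x" "coord2 y"] by (simp add: soc_def)
qed

lemma soc_inner_nonneg:
  assumes "x \<in> soc" "y \<in> soc" shows "0 \<le> x \<bullet> y"
proof -
  have "- (coord2 x \<bullet> coord2 y) \<le> norm (coord2 x) * norm (coord2 y)"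
    using Cauchy_Schwarz_ineq2[of "coord2 x" "coord2 y"] by linarith
  also have "\<dots> \<le> coord1 x * coord1 y"
    using assms order_trans[OF norm_ge_zero, of "coord2 x" "coord1 x"]
    by (intro mult_mono) (simp_all add: soc_def)
  finally show ?thesis by (simp add: inner_split[of x y])
qed

lemma soc_self_dual:
  assumes "\<And>d. d \<in> soc \<Longrightarrow> 0 \<le> x \<bullet> d" shows "x \<in> soc"
proof (cases "coord2 x = 0")
  case True
  then show ?thesis using assms[OF axis1_in_soc] by (simp add: soc_def coord1_inner)
next
  case False
  \<comment> \<open>the boundary ray opposite to \<open>x\<^sub>2\<close> is the most restrictive test vector\<close>
  define d where "d = norm (coord2 x) *\<^sub>R axis1 - coord2 x"
  have c: "coord1 d = norm (coord2 x)" "coord2 d = - coord2 x"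
    by (simp_all add: d_def coord2_eq)
  have "0 \<le> x \<bullet> d" by (rule assms) (simp add: soc_def c)
  then have "norm (coord2 x) * norm (coord2 x) \<le> coord1 x * norm (coord2 x)"
    unfolding inner_split[of x d] c inner_minus_right
    by (simp add: dot_square_norm power2_eq_square)
  then show ?thesis using False by (simp add: soc_def)
qed

lemma soc_coord1_pos: assumes "x \<in> soc" "x \<noteq> 0" shows "0 < coord1 x"
proof (rule ccontr)
  assume "\<not> 0 < coord1 x"
  with assms(1) have "norm (coord2 x) \<le> coord1 x" "coord1 x \<le> 0" by (auto simp: soc_def)
  then have "coord1 x = 0" "norm (coord2 x) = 0"
    using norm_ge_zero[of "coord2 x"] by linarith+
  then show False using assms(2) by (simp add: coord2_eq)
qed

lemma closed_soc: "closed soc"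
proof -
  have "soc = {x. 0 \<le> coord1 x \<and> 0 \<le> x \<bullet> reflect x}" by (auto simp: soc_iff)
  also have "closed \<dots>" by (intro closed_Collect_conj closed_Collect_le continuous_intros)
  finally show ?thesis .
qed

text \<open>A point of the interior can be shifted by a small amount against the axis without leaving the cone,
  which makes the defining inequality strict.\<close>

lemma interior_soc: "interior soc = {x. 0 < coord1 x \<and> 0 < x \<bullet> reflect x}" (is "_ = ?I")
proof
  have "open ?I" by (intro open_Collect_conj open_Collect_less continuous_intros)
  then show "?I \<subseteq> interior soc" by (intro interior_maximal) (auto simp: soc_iff)
  show "interior soc \<subseteq> ?I"
  proof
    fix x :: "real ^ 'a::{finite,linorder}" assume "x \<in> interior soc"
    then obtain e where e: "e > 0" "cball x e \<subseteq> soc" by (auto simp: mem_interior_cball)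
    have "x - e *\<^sub>R axis1 \<in> soc"
      using e by (intro subsetD[OF e(2)]) (simp add: dist_norm norm_eq_sqrt_inner)
    then have "norm (coord2 x) \<le> coord1 x - e" by (simp add: soc_def coord2_eq algebra_simps)
    then have *: "norm (coord2 x) < coord1 x" using e by simp
    then have "(norm (coord2 x))\<^sup>2 < (coord1 x)\<^sup>2" by (intro power_strict_mono) auto
    moreover have "0 < coord1 x" using * norm_ge_zero[of "coord2 x"] by linarith
    ultimately show "x \<in> ?I"
      unfolding norm_coord2 by (simp add: inner_reflect power2_eq_square mult.assoc)
  qed
qed

lemma frontier_soc: "x \<in> frontier soc \<longleftrightarrow> 0 \<le> coord1 x \<and> x \<bullet> reflect x = 0"
proof -
  have "x \<bullet> reflect x \<le> 0" if "coord1 x = 0"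
    using that by (simp add: inner_reflect)
  moreover have "x \<in> frontier soc \<longleftrightarrow> x \<in> soc \<and> x \<notin> interior soc"
    by (simp add: frontier_def closure_closed[OF closed_soc])
  ultimately show ?thesis
    by (cases "coord1 x = 0") (auto simp: interior_soc soc_iff)
qed

lemma soc_compl_iff: "(x, y) \<in> soc_compl \<longleftrightarrow> x \<in> soc \<and> y \<in> soc \<and> x \<bullet> y = 0"
  by (simp add: soc_compl_def)

lemma soc_compl_swap: "(x, y) \<in> soc_compl \<longleftrightarrow> (y, x) \<in> soc_compl"
  by (auto simp: soc_compl_iff inner_commute)

text \<open>Expanding the squared norm of the difference of the two sides, the terms with \<open>x \<bullet> y\<close> vanish, and
  the bounds \<open>\<parallel>x\<parallel>\<^sup>2 \<le> 2 x\<^sub>1\<^sup>2\<close> and \<open>\<parallel>y\<parallel>\<^sup>2 \<le> 2 y\<^sub>1\<^sup>2\<close> make what remains nonpositive.\<close>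

lemma soc_compl_parallel:
  assumes "(x, y) \<in> soc_compl"
  shows "coord1 x *\<^sub>R y = coord1 y *\<^sub>R reflect x"
proof -
  let ?a = "coord1 x" and ?b = "coord1 y"
  have xy: "x \<bullet> y = 0" "x \<bullet> x \<le> 2 * ?a\<^sup>2" "y \<bullet> y \<le> 2 * ?b\<^sup>2"
    using assms by (auto simp: soc_compl_iff soc_iff inner_reflect power2_eq_square)
  have "(norm (?a *\<^sub>R y - ?b *\<^sub>R reflect x))\<^sup>2 = ?a\<^sup>2 * (y \<bullet> y) + ?b\<^sup>2 * (x \<bullet> x) - 4 * ?a\<^sup>2 * ?b\<^sup>2"
    unfolding power2_norm_eq_inner using xy(1)
    by (simp add: inner_diff_left inner_diff_right reflect_inner inner_reflect inner_commute
        power2_eq_square algebra_simps)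
  also have "\<dots> \<le> ?a\<^sup>2 * (2 * ?b\<^sup>2) + ?b\<^sup>2 * (2 * ?a\<^sup>2) - 4 * ?a\<^sup>2 * ?b\<^sup>2"
    using xy by (intro diff_right_mono add_mono mult_left_mono) auto
  also have "\<dots> = 0" by (simp add: algebra_simps)
  finally show ?thesis by simp
qed

lemma soc_compl_frontier:
  assumes "(x, y) \<in> soc_compl" "y \<noteq> 0"
  shows "x \<in> frontier soc"
proof -
  have "0 < coord1 y" using assms by (auto simp: soc_compl_iff intro: soc_coord1_pos)
  moreover have "coord1 y * (x \<bullet> reflect x) = 0"
    using soc_compl_parallel[OF assms(1)] assms(1)
    by (metis inner_scaleR_right mult_zero_right soc_compl_iff)
  ultimately show ?thesis using assms by (simp add: frontier_soc soc_compl_iff soc_iff)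
qed

lemma soc_compl_frontier':
  "(x, y) \<in> soc_compl \<Longrightarrow> x \<noteq> 0 \<Longrightarrow> y \<in> frontier soc"
  using soc_compl_frontier[of y x] soc_compl_swap[of x y] by simp

text \<open>For boundary points \<open>\<parallel>p - x\<parallel>\<^sup>2 = 2 (x \<bullet> reflect p) + 2 (p\<^sub>1 - x\<^sub>1)\<^sup>2\<close>: the linear function that
  supports the cone at \<open>x\<close> grows only quadratically along the boundary.\<close>

lemma frontier_inner_reflect_le:
  assumes "x \<in> frontier soc" "p \<in> frontier soc"
  shows "x \<bullet> reflect p \<le> (norm (p - x))\<^sup>2"
proof -
  have e: "x \<bullet> x = 2 * (coord1 x * coord1 x)" "p \<bullet> p = 2 * (coord1 p * coord1 p)"
    using assms by (auto simp: frontier_soc inner_reflect)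
  have "(norm (p - x))\<^sup>2 = p \<bullet> p - 2 * (x \<bullet> p) + x \<bullet> x"
    unfolding power2_norm_eq_inner
    by (simp add: inner_diff_left inner_diff_right inner_commute)
  also have "\<dots> = x \<bullet> reflect p + x \<bullet> reflect p + 2 * (coord1 p - coord1 x)\<^sup>2"
    using e by (simp add: inner_reflect power2_eq_square algebra_simps)
  finally have "(norm (p - x))\<^sup>2 = x \<bullet> reflect p + x \<bullet> reflect p + 2 * (coord1 p - coord1 x)\<^sup>2" .
  moreover have "0 \<le> x \<bullet> reflect p"
    using assms by (intro soc_inner_nonneg) (auto simp: frontier_soc soc_iff reflect_inner_eq inner_reflect)
  moreover have "0 \<le> (coord1 p - coord1 x)\<^sup>2" by simp
  ultimately show ?thesis by linarith
qed

lemma soc_compl_ray: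
  assumes "(x, y) \<in> soc_compl" "y \<noteq> 0"
  shows "x = (coord1 x / coord1 y) *\<^sub>R reflect y"
proof -
  have "coord1 y \<noteq> 0" using soc_coord1_pos[of y] assms by (auto simp: soc_compl_iff)
  have "reflect (coord1 x *\<^sub>R y) = reflect (coord1 y *\<^sub>R reflect x)"
    using soc_compl_parallel[OF assms(1)] by simp
  then have "coord1 y *\<^sub>R x = coord1 x *\<^sub>R reflect y" by simp
  then have "(1 / coord1 y) *\<^sub>R coord1 y *\<^sub>R x = (1 / coord1 y) *\<^sub>R coord1 x *\<^sub>R reflect y"
    by simp
  then show ?thesis using \<open>coord1 y \<noteq> 0\<close> by simp
qed

lemma soc_compl_interior:
  assumes "(x, y) \<in> soc_compl" "y \<in> interior soc" shows "x = 0"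
  using soc_compl_frontier'[OF assms(1)] assms(2) by (auto simp: frontier_def)

lemma frontier_subset_soc: "x \<in> frontier soc \<Longrightarrow> x \<in> soc"
  by (simp add: frontier_soc soc_iff)

lemma frontier_soc_pair:
  assumes "y \<in> frontier soc" "0 \<le> t" shows "(t *\<^sub>R reflect y, y) \<in> soc_compl"
  using assms frontier_subset_soc[OF assms(1)]
  by (simp add: soc_compl_iff soc_scaleR frontier_soc reflect_inner)

section \<open>Regular and proximal normals, stratum by stratum\<close>

lemma abs_inner_le: "norm b \<le> N \<Longrightarrow> \<bar>a \<bullet> b\<bar> \<le> norm a * N"
  by (rule order_trans[OF Cauchy_Schwarz_ineq2 mult_left_mono]) simp_all

text \<open>Near \<open>(0, y)\<close> the second component moves freely, so it may be moved in the direction \<open>v\<close> itself.\<close>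

lemma regular_normal_apex_interior:
  assumes y: "y \<in> interior soc" and w: "(u, v) \<in> regular_normal_cone soc_compl (0, y)"
  shows "v = 0"
proof -
  obtain e where e: "e > 0" "ball y e \<subseteq> soc" using y by (auto simp: mem_interior)
  have "(u, v) \<bullet> (0, v) \<le> 0"
  proof (rule regular_normal_segment[OF w, where \<delta> = "e / (norm v + 1)"])
    show "0 < e / (norm v + 1)" using e by (simp add: add_nonneg_pos)
    fix t assume t: "0 < t" "t < e / (norm v + 1)"
    moreover have "0 < norm v + 1" by (simp add: add_nonneg_pos)
    ultimately have "t * (norm v + 1) < e" by (simp only: pos_less_divide_eq)
    then have "y + t *\<^sub>R v \<in> soc"
      using t by (intro subsetD[OF e(2)]) (simp add: dist_norm algebra_simps)
    then show "(0, y) + t *\<^sub>R (0, v) \<in> soc_compl" by (simp add: soc_compl_iff)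
  qed
  then show ?thesis using inner_ge_zero[of v] by (simp add: order_antisym_conv)
qed

text \<open>Points of \<open>\<Omega>\<close> with a nonzero first component keep a fixed distance from \<open>(0, y)\<close>, and at a
  distance bounded below a linear bound is a quadratic one.\<close>

lemma proximal_normal_apex_interior:
  assumes y: "y \<in> interior soc"
  shows "(u, 0) \<in> proximal_normal_cone soc_compl (0, y)"
proof -
  obtain e where e: "e > 0" "ball y e \<subseteq> interior soc"
    using y by (auto simp: mem_interior interior_subset intro: that[OF _ interior_maximal])
  have "(u, 0) \<bullet> (p - (0, y)) \<le> (norm u / e + 1) * (norm (p - (0, y)))\<^sup>2"
    if p: "p \<in> soc_compl" for p
  proof -
    obtain a b where ab: "p = (a, b)" by (cases p)
    let ?N = "norm (p - (0, y))"
    have na: "norm a \<le> ?N" and nb: "norm (b - y) \<le> ?N"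
      using norm_fst_le[of a "b - y"] norm_snd_le[of "b - y" a] by (simp_all add: ab)
    show ?thesis
    proof (cases "a = 0")
      case True
      then show ?thesis using e by (simp add: ab)
    next
      case False
      then have "b \<notin> interior soc" using soc_compl_interior p ab by blast
      then have "e \<le> norm (b - y)"
        using e(2) by (force simp: dist_norm norm_minus_commute not_less[symmetric])
      then have N: "e \<le> ?N" using nb by linarith
      have "u \<bullet> a \<le> norm u * ?N"
        using abs_inner_le[OF na, of u] by linarith
      also have "\<dots> = norm u / e * (e * ?N)" using e by simp
      also have "\<dots> \<le> norm u / e * (?N * ?N)"
        using e N by (intro mult_left_mono mult_right_mono) auto
      also have "\<dots> \<le> (norm u / e + 1) * ?N\<^sup>2"
        by (simp add: power2_eq_square algebra_simps)
      finally show ?thesis by (simp add: ab)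
    qed
  qed
  moreover have "norm u / e + 1 > 0" using e by (simp add: add_nonneg_pos)
  ultimately show ?thesis unfolding proximal_normal_cone_def by blast
qed

text \<open>Keeping the first component zero leaves all of \<open>\<K>\<close> to the second one, so \<open>v\<close> is an ordinary normal
  of this convex cone at \<open>y\<close>, that is, \<open>-v\<close> lies in the dual cone \<open>\<K>\<close> and is orthogonal to \<open>y\<close>.\<close>

lemma regular_normal_apex:
  assumes y: "y \<in> soc" and w: "(u, v) \<in> regular_normal_cone soc_compl (0, y)"
  shows "- v \<in> soc" "v \<bullet> y = 0"
proof -
  have d: "v \<bullet> d \<le> 0" if "d \<in> soc" for d
  proof -
    have "(u, v) \<bullet> (0, d) \<le> 0"
      by (rule regular_normal_segment[OF w zero_less_one])
         (simp add: soc_compl_iff soc_add[OF y soc_scaleR[OF that]])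
    then show ?thesis by simp
  qed
  then show "- v \<in> soc" by (intro soc_self_dual) simp
  have "(u, v) \<bullet> (0, - y) \<le> 0"
  proof (rule regular_normal_segment[OF w zero_less_one])
    fix t :: real assume "0 < t" "t < 1"
    then show "(0, y) + t *\<^sub>R (0, - y) \<in> soc_compl"
      using soc_scaleR[OF y, of "1 - t"] by (simp add: soc_compl_iff algebra_simps)
  qed
  with d[OF y] show "v \<bullet> y = 0" by simp
qed

text \<open>Besides \<open>y\<close>, the first component can now leave zero along \<open>reflect y\<close>.  The condition on \<open>v\<close> says
  that \<open>(- v, y)\<close> again belongs to \<open>\<Omega>\<close>, where \<open>- v\<close> must be a nonnegative multiple of \<open>reflect y\<close>.\<close>

lemma regular_normal_apex_frontier:
  assumes y: "y \<in> frontier soc" "y \<noteq> 0"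
    and w: "(u, v) \<in> regular_normal_cone soc_compl (0, y)"
  shows "u \<bullet> reflect y \<le> 0" "\<exists>c\<le>0. v = c *\<^sub>R reflect y"
proof -
  have "(u, v) \<bullet> (reflect y, 0) \<le> 0"
    by (rule regular_normal_segment[OF w zero_less_one])
       (simp add: frontier_soc_pair[OF y(1)])
  then show "u \<bullet> reflect y \<le> 0" by simp
  have y': "y \<in> soc" by (rule frontier_subset_soc[OF y(1)])
  from regular_normal_apex[OF y' w] have "(- v, y) \<in> soc_compl"
    using y' by (simp add: soc_compl_iff)
  from soc_compl_ray[OF this y(2)] have "v = - ((coord1 (- v) / coord1 y) *\<^sub>R reflect y)"
    by (metis minus_minus)
  moreover have "0 \<le> coord1 (- v) / coord1 y"
    using regular_normal_apex(1)[OF y' w] y' by (simp only: soc_iff divide_nonneg_nonneg)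
  ultimately show "\<exists>c\<le>0. v = c *\<^sub>R reflect y"
    by (intro exI[of _ "- (coord1 (- v) / coord1 y)"]) (metis neg_le_0_iff_le scaleR_minus_left)
qed

text \<open>At a point \<open>(a, b)\<close> of \<open>\<Omega>\<close> the part from \<open>v\<close> is nonpositive by duality.  In the part from \<open>u\<close>,
  replacing \<open>y\<^sub>1 a\<close> by \<open>b\<^sub>1 a = a\<^sub>1 reflect b\<close> and then \<open>b\<close> by \<open>y\<close> costs two products of increments
  and leaves \<open>a\<^sub>1 (u \<bullet> reflect y) \<le> 0\<close>.\<close>

lemma proximal_normal_apex_frontier:
  assumes y: "y \<in> frontier soc" "y \<noteq> 0" and u: "u \<bullet> reflect y \<le> 0" and c: "c \<le> 0"
  shows "(u, c *\<^sub>R reflect y) \<in> proximal_normal_cone soc_compl (0, y)"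
proof -
  have ys: "y \<in> soc" and yy: "reflect y \<bullet> y = 0"
    using y by (auto simp: frontier_subset_soc frontier_soc reflect_inner)
  have y1: "0 < coord1 y" using soc_coord1_pos[OF ys y(2)] .
  have "(u, c *\<^sub>R reflect y) \<bullet> (p - (0, y)) \<le> (2 * norm u / coord1 y + 1) * (norm (p - (0, y)))\<^sup>2"
    if p: "p \<in> soc_compl" for p
  proof -
    obtain a b where ab: "p = (a, b)" by (cases p)
    let ?N = "norm (p - (0, y))"
    have na: "norm a \<le> ?N" and nb: "norm (b - y) \<le> ?N"
      using norm_fst_le[of a "b - y"] norm_snd_le[of "b - y" a] by (simp_all add: ab)
    have abs: "a \<in> soc" "b \<in> soc" using p by (auto simp: ab soc_compl_iff)
    have par: "coord1 b *\<^sub>R a = coord1 a *\<^sub>R reflect b"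
      using soc_compl_parallel[of b a] p soc_compl_swap by (auto simp: ab)
    have a1: "0 \<le> coord1 a" "coord1 a \<le> ?N"
      using abs abs_coord1_le[of a] na by (auto simp: soc_iff)
    have b1: "\<bar>coord1 y - coord1 b\<bar> \<le> ?N"
      using abs_coord1_le[of "b - y"] nb by simp
    have "coord1 y * (u \<bullet> a) = (coord1 y - coord1 b) * (u \<bullet> a) + u \<bullet> (coord1 b *\<^sub>R a)"
      by (simp add: algebra_simps)
    also have "\<dots> = (coord1 y - coord1 b) * (u \<bullet> a) + coord1 a * (u \<bullet> reflect (b - y))
        + coord1 a * (u \<bullet> reflect y)"
      unfolding par by (simp add: algebra_simps inner_diff_right)
    also have "\<dots> \<le> ?N * (norm u * ?N) + ?N * (norm u * ?N) + 0"
    proof (intro add_mono)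
      have "\<bar>u \<bullet> a\<bar> \<le> norm u * ?N"
        by (rule abs_inner_le[OF na])
      then have "\<bar>(coord1 y - coord1 b) * (u \<bullet> a)\<bar> \<le> ?N * (norm u * ?N)"
        unfolding abs_mult using b1 by (intro mult_mono) auto
      then show "(coord1 y - coord1 b) * (u \<bullet> a) \<le> ?N * (norm u * ?N)" by linarith
      have "u \<bullet> reflect (b - y) \<le> norm u * ?N"
        using abs_inner_le[of "reflect (b - y)" ?N u] nb unfolding norm_reflect by linarith
      then have "coord1 a * (u \<bullet> reflect (b - y)) \<le> coord1 a * (norm u * ?N)"
        using a1 by (intro mult_left_mono)
      also have "\<dots> \<le> ?N * (norm u * ?N)"
        using a1 by (intro mult_right_mono) auto
      finally show "coord1 a * (u \<bullet> reflect (b - y)) \<le> ?N * (norm u * ?N)" .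
      show "coord1 a * (u \<bullet> reflect y) \<le> 0"
        using a1 u by (rule_tac mult_nonneg_nonpos)
    qed
    finally have "coord1 y * (u \<bullet> a) \<le> 2 * norm u * ?N\<^sup>2"
      by (simp add: power2_eq_square algebra_simps)
    then have ua: "u \<bullet> a \<le> 2 * norm u / coord1 y * ?N\<^sup>2"
      using y1 by (simp add: field_simps)
    have "0 \<le> reflect y \<bullet> b" using ys abs by (intro soc_inner_nonneg) auto
    then have "c * (reflect y \<bullet> b) \<le> 0" using c by (intro mult_nonpos_nonneg)
    then have "(u, c *\<^sub>R reflect y) \<bullet> (p - (0, y)) \<le> u \<bullet> a"
      using yy by (simp add: ab inner_diff_right)
    also note ua
    also have "2 * norm u / coord1 y * ?N\<^sup>2 \<le> (2 * norm u / coord1 y + 1) * ?N\<^sup>2"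
      by (intro mult_right_mono) auto
    finally show ?thesis .
  qed
  moreover have "2 * norm u / coord1 y + 1 > 0" using y1 by (simp add: add_nonneg_pos)
  ultimately show ?thesis unfolding proximal_normal_cone_def by blast
qed

text \<open>The orthogonality relations come from moving along the rays through \<open>x\<close> and \<open>y\<close>.  For the third
  relation let \<open>p = x\<^sub>1 reflect u + y\<^sub>1 v\<close>, and let \<open>- d\<close> be the part of \<open>p\<close> that is not accounted for by
  a multiple of \<open>x\<close>.  The vector \<open>d\<close> is tangent to the boundary of the cone at \<open>x\<close> and has no axial
  component; moving \<open>x\<close> in this direction along the boundary, with \<open>y\<close> following as
  \<open>k reflect x\<close>, gives \<open>d \<bullet> d \<le> 0\<close>.\<close>

lemma regular_normal_smooth:
  fixes x y u v :: "real ^ 'm::{finite,linorder}"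
  assumes xy: "(x, y) \<in> soc_compl" "x \<noteq> 0" "y \<noteq> 0"
    and w: "(u, v) \<in> regular_normal_cone soc_compl (x, y)"
  shows "u \<bullet> x = 0" "v \<bullet> y = 0" "\<exists>c. coord1 x *\<^sub>R reflect u + coord1 y *\<^sub>R v = c *\<^sub>R x"
proof -
  have s: "x \<in> soc" "y \<in> soc" "x \<bullet> y = 0" using xy by (auto simp: soc_compl_iff)
  have pos: "0 < coord1 x" "0 < coord1 y" using soc_coord1_pos s xy by auto
  have par: "coord1 x *\<^sub>R y = coord1 y *\<^sub>R reflect x" by (rule soc_compl_parallel[OF xy(1)])
  have xx: "x \<bullet> reflect x = 0" using soc_compl_frontier[OF xy(1,3)] by (simp add: frontier_soc)
  have radial: "(u, v) \<bullet> (a *\<^sub>R x, b *\<^sub>R y) \<le> 0" if "a \<in> {-1,0,1}" "b \<in> {-1,0,1}" for a b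
  proof (rule regular_normal_segment[OF w zero_less_one])
    fix t :: real assume t: "0 < t" "t < 1"
    then have "(1 + t * a) *\<^sub>R x \<in> soc" "(1 + t * b) *\<^sub>R y \<in> soc"
      using that by (auto intro!: soc_scaleR s)
    then show "(x, y) + t *\<^sub>R (a *\<^sub>R x, b *\<^sub>R y) \<in> soc_compl"
      using s by (simp add: soc_compl_iff algebra_simps)
  qed
  show ux: "u \<bullet> x = 0" using radial[of 1 0] radial[of "-1" 0] by simp
  show vy: "v \<bullet> y = 0" using radial[of 0 1] radial[of 0 "-1"] by simp
  have vx: "v \<bullet> reflect x = 0"
    using vy par pos by (metis inner_scaleR_right mult_eq_0_iff less_irrefl)
  define p where "p = coord1 x *\<^sub>R reflect u + coord1 y *\<^sub>R v"
  define c where "c = coord1 p / coord1 x"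
  define k where "k = coord1 y / coord1 x"
  define d where "d = c *\<^sub>R x - p"
  have yk: "y = k *\<^sub>R reflect x"
    using soc_compl_ray[of y x] xy soc_compl_swap[of x y] by (simp add: k_def)
  have px: "p \<bullet> reflect x = 0"
    using ux vx by (simp add: p_def inner_add_left)
  have d1: "coord1 d = 0" using pos by (simp add: d_def c_def)
  have dx: "d \<bullet> x = 0" "d \<bullet> reflect x = 0"
    using px xx d1 inner_reflect[of d x] by (simp_all add: d_def inner_diff_left)
  have "(u, v) \<bullet> (d, - k *\<^sub>R d) \<le> 0"
  proof (rule regular_normal_curve[OF w])
    \<comment> \<open>\<open>h t\<close> is the axial shift that puts \<open>x + t d\<close> back on the boundary; it is of second order\<close>
    define h where "h t = sqrt ((coord1 x)\<^sup>2 + t\<^sup>2 * (d \<bullet> d)) - coord1 x" for t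
    have h: "0 \<le> h t" "(coord1 x + h t)\<^sup>2 = (coord1 x)\<^sup>2 + t\<^sup>2 * (d \<bullet> d)" for t
    proof -
      show "(coord1 x + h t)\<^sup>2 = (coord1 x)\<^sup>2 + t\<^sup>2 * (d \<bullet> d)"
        by (simp add: h_def)
      have "coord1 x \<le> sqrt ((coord1 x)\<^sup>2 + t\<^sup>2 * (d \<bullet> d))"
        by (rule real_le_rsqrt) simp
      then show "0 \<le> h t" by (simp add: h_def)
    qed
    have h2: "h t \<le> (d \<bullet> d) / (2 * coord1 x) * t\<^sup>2" for t
    proof -
      have "2 * coord1 x * h t \<le> t\<^sup>2 * (d \<bullet> d)"
        using h(2)[of t] zero_le_power2[of "h t"] unfolding power2_sum by linarith
      then show ?thesis using pos by (simp add: field_simps)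
    qed
    define E :: "(real ^ 'm::{finite,linorder}) \<times> (real ^ 'm::{finite,linorder})" where "E = (axis1, k *\<^sub>R axis1)"
    have "\<exists>q\<in>soc_compl. norm (q - (x, y) - t *\<^sub>R (d, - k *\<^sub>R d))
        \<le> norm E * ((d \<bullet> d) / (2 * coord1 x)) * t\<^sup>2" for t
    proof -
      define q where "q = x + t *\<^sub>R d + h t *\<^sub>R axis1"
      have q1: "coord1 q = coord1 x + h t" by (simp add: q_def d1)
      have rd: "reflect d = - d" by (simp add: reflect_eq d1)
      have ra: "reflect axis1 = (axis1 :: real ^ 'm::{finite,linorder})" by (simp add: reflect_eq scaleR_2)
      have "q \<bullet> q = x \<bullet> x + t\<^sup>2 * (d \<bullet> d) + (2 * coord1 x * h t + (h t)\<^sup>2)"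
        using d1 dx(1)
        by (simp add: q_def inner_add_left inner_add_right coord1_inner inner_commute
            power2_eq_square algebra_simps)
      moreover have "x \<bullet> x = 2 * (coord1 x)\<^sup>2"
        using xx by (simp add: inner_reflect power2_eq_square)
      ultimately have "q \<bullet> reflect q = 0"
        using h(2)[of t] unfolding inner_reflect q1 by (simp add: power2_eq_square algebra_simps)
      then have qf: "reflect q \<in> frontier soc"
        using h(1)[of t] pos by (simp add: frontier_soc reflect_inner_eq inner_reflect q1)
      have "0 \<le> k" using pos by (simp add: k_def)
      have "(q, k *\<^sub>R reflect q) \<in> soc_compl"
        using frontier_soc_pair[OF qf zero_le_one] soc_scaleR[OF _ \<open>0 \<le> k\<close>, of "reflect q"]
        by (simp add: soc_compl_iff)
      moreover have "(q, k *\<^sub>R reflect q) - (x, y) - t *\<^sub>R (d, - k *\<^sub>R d)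
          = h t *\<^sub>R E"
        by (simp add: E_def q_def yk rd ra algebra_simps)
      moreover have "norm (h t *\<^sub>R E) \<le> norm E * ((d \<bullet> d) / (2 * coord1 x)) * t\<^sup>2"
        using mult_left_mono[OF h2[of t] norm_ge_zero[of E]] h(1)[of t]
        by (simp add: mult_ac)
      ultimately show ?thesis by (intro bexI[of _ "(q, k *\<^sub>R reflect q)"]) auto
    qed
    then show "\<forall>\<^sub>F t in at_right 0. \<exists>q\<in>soc_compl. norm (q - (x, y) - t *\<^sub>R (d, - k *\<^sub>R d))
        \<le> norm E * ((d \<bullet> d) / (2 * coord1 x)) * t\<^sup>2"
      by simp
  qed
  then have "u \<bullet> d - k * (v \<bullet> d) \<le> 0" by simp
  then have "coord1 x * (u \<bullet> d - k * (v \<bullet> d)) \<le> 0"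
    using pos by (intro mult_nonneg_nonpos) auto
  moreover have "coord1 x * k = coord1 y" using pos by (simp add: k_def)
  ultimately have "coord1 x * (u \<bullet> d) - coord1 y * (v \<bullet> d) \<le> 0"
    by (simp add: right_diff_distrib mult.assoc[symmetric])
  moreover have "p \<bullet> d = - (coord1 x * (u \<bullet> d)) + coord1 y * (v \<bullet> d)"
    by (simp add: p_def inner_add_left reflect_inner_eq d1)
  ultimately have "- (p \<bullet> d) \<le> 0" by simp
  moreover have "d \<bullet> d = - (p \<bullet> d)"
    using dx(1) by (simp add: d_def[THEN arg_cong[where f = "\<lambda>z. z \<bullet> d"]] inner_diff_left inner_diff_right inner_commute)
  ultimately have "d = 0" by (metis inner_eq_zero_iff inner_ge_zero order_antisym)
  then show "\<exists>c. coord1 x *\<^sub>R reflect u + coord1 y *\<^sub>R v = c *\<^sub>R x"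
    by (intro exI[of _ c]) (simp add: d_def p_def)
qed

text \<open>After multiplication with \<open>x\<^sub>1\<close>, the increment at a point \<open>(a, b)\<close> of \<open>\<Omega>\<close> becomes
  \<open>c (reflect x \<bullet> a) + v \<bullet> (x\<^sub>1 b - y\<^sub>1 reflect a)\<close>.  The first summand is quadratically small on the
  boundary of the cone; in the second one, subtracting the identity \<open>a\<^sub>1 b = b\<^sub>1 reflect a\<close> leaves
  products of two increments and terms orthogonal to \<open>v\<close>.\<close>

lemma proximal_normal_smooth:
  assumes xy: "(x, y) \<in> soc_compl" "x \<noteq> 0" "y \<noteq> 0"
    and ux: "u \<bullet> x = 0" and vy: "v \<bullet> y = 0"
    and c: "coord1 x *\<^sub>R reflect u + coord1 y *\<^sub>R v = c *\<^sub>R x"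
  shows "(u, v) \<in> proximal_normal_cone soc_compl (x, y)"
proof -
  have s: "x \<in> soc" "y \<in> soc" "x \<bullet> y = 0" using xy by (auto simp: soc_compl_iff)
  have pos: "0 < coord1 x" "0 < coord1 y" using soc_coord1_pos s xy by auto
  have par: "coord1 x *\<^sub>R y = coord1 y *\<^sub>R reflect x" by (rule soc_compl_parallel[OF xy(1)])
  have xf: "x \<in> frontier soc" using soc_compl_frontier[OF xy(1,3)] .
  then have xx: "x \<bullet> reflect x = 0" by (simp add: frontier_soc)
  have vx: "v \<bullet> reflect x = 0"
    using vy par pos by (metis inner_scaleR_right mult_eq_0_iff less_irrefl)
  have "reflect (coord1 x *\<^sub>R reflect u + coord1 y *\<^sub>R v) = reflect (c *\<^sub>R x)" using c by simp
  then have u: "coord1 x *\<^sub>R u = c *\<^sub>R reflect x - coord1 y *\<^sub>R reflect v"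
    by (simp add: algebra_simps)
  \<comment> \<open>if \<open>a\<close> is off the boundary then \<open>b = 0\<close>, the distance is at least \<open>norm y\<close>, and the second
    summand of \<open>B\<close> turns the linear bound into a quadratic one\<close>
  define B where "B = 1 + norm x / norm y"
  have B: "B \<ge> 1" "B \<ge> norm x / norm y" by (simp_all add: B_def)
  define M where "M = (\<bar>c\<bar> * B + 2 * norm v) / coord1 x + 1"
  have "(u, v) \<bullet> (p - (x, y)) \<le> M * (norm (p - (x, y)))\<^sup>2" if p: "p \<in> soc_compl" for p
  proof -
    obtain a b where ab: "p = (a, b)" by (cases p)
    define N where "N = norm (p - (x, y))"
    have N0: "0 \<le> N" by (simp add: N_def)
    have na: "norm (a - x) \<le> N" and nb: "norm (b - y) \<le> N"
      using norm_fst_le[of "a - x" "b - y"] norm_snd_le[of "b - y" "a - x"] by (simp_all add: ab N_def)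
    have abc: "(a, b) \<in> soc_compl" using p ab by simp
    have abs: "a \<in> soc" "b \<in> soc" using p by (auto simp: ab soc_compl_iff)
    have parab: "coord1 a *\<^sub>R b = coord1 b *\<^sub>R reflect a" by (rule soc_compl_parallel[OF abc])
    have curv: "\<bar>reflect x \<bullet> a\<bar> \<le> B * N\<^sup>2"
    proof (cases "b = 0")
      case False
      have "0 \<le> reflect x \<bullet> a" using s abs by (intro soc_inner_nonneg) auto
      moreover have "x \<bullet> reflect a \<le> (norm (a - x))\<^sup>2"
        by (rule frontier_inner_reflect_le[OF xf soc_compl_frontier[OF abc False]])
      moreover have "(norm (a - x))\<^sup>2 \<le> N\<^sup>2" using na by (intro power_mono) auto
      moreover have "N\<^sup>2 \<le> B * N\<^sup>2" using B mult_right_mono[of 1 B "N\<^sup>2"] by simp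
      ultimately show ?thesis by (simp add: reflect_inner)
    next
      case True
      then have yN: "norm y \<le> N" using nb by simp
      have "\<bar>reflect x \<bullet> a\<bar> = \<bar>reflect x \<bullet> (a - x)\<bar>"
        using xx by (simp add: inner_diff_right reflect_inner)
      also have "\<dots> \<le> norm x * N"
        using abs_inner_le[OF na, of "reflect x"] by simp
      also have "\<dots> = norm x / norm y * (norm y * N)" using xy by simp
      also have "\<dots> \<le> norm x / norm y * (N * N)"
        using yN N0 by (intro mult_left_mono mult_right_mono) auto
      also have "\<dots> \<le> B * (N * N)" using B by (intro mult_right_mono) auto
      finally show ?thesis by (simp add: power2_eq_square)
    qed
    have split: "coord1 x *\<^sub>R b - coord1 y *\<^sub>R reflect a
      = (coord1 x - coord1 a) *\<^sub>R (b - y) + (coord1 b - coord1 y) *\<^sub>R reflect (a - x)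
        + ((coord1 x - coord1 a) *\<^sub>R y + (coord1 b - coord1 y) *\<^sub>R reflect x)"
      using parab by (simp add: algebra_simps)
    have "v \<bullet> (coord1 x *\<^sub>R b - coord1 y *\<^sub>R reflect a)
      = (coord1 x - coord1 a) * (v \<bullet> (b - y)) + (coord1 b - coord1 y) * (v \<bullet> reflect (a - x))"
      unfolding split inner_add_right inner_scaleR_right vy vx by simp
    also have "\<dots> \<le> N * (norm v * N) + N * (norm v * N)"
    proof (intro add_mono)
      have "\<bar>coord1 x - coord1 a\<bar> \<le> N" using abs_coord1_le[of "a - x"] na by simp
      moreover have "\<bar>v \<bullet> (b - y)\<bar> \<le> norm v * N"
        by (rule abs_inner_le[OF nb])
      ultimately have "\<bar>(coord1 x - coord1 a) * (v \<bullet> (b - y))\<bar> \<le> N * (norm v * N)"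
        unfolding abs_mult using N0 by (intro mult_mono) auto
      then show "(coord1 x - coord1 a) * (v \<bullet> (b - y)) \<le> N * (norm v * N)" by linarith
      have "\<bar>coord1 b - coord1 y\<bar> \<le> N" using abs_coord1_le[of "b - y"] nb by simp
      moreover have "\<bar>v \<bullet> reflect (a - x)\<bar> \<le> norm v * N"
        using na by (intro abs_inner_le) (simp only: norm_reflect)
      ultimately have "\<bar>(coord1 b - coord1 y) * (v \<bullet> reflect (a - x))\<bar> \<le> N * (norm v * N)"
        unfolding abs_mult using N0 by (intro mult_mono) auto
      then show "(coord1 b - coord1 y) * (v \<bullet> reflect (a - x)) \<le> N * (norm v * N)" by linarith
    qed
    finally have 1: "v \<bullet> (coord1 x *\<^sub>R b - coord1 y *\<^sub>R reflect a) \<le> 2 * norm v * N\<^sup>2"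
      by (simp add: power2_eq_square algebra_simps)
    have "c * (reflect x \<bullet> a) \<le> \<bar>c\<bar> * \<bar>reflect x \<bullet> a\<bar>"
      by (metis abs_ge_self abs_mult)
    also have "\<dots> \<le> \<bar>c\<bar> * (B * N\<^sup>2)" using curv by (intro mult_left_mono) auto
    finally have 2: "c * (reflect x \<bullet> a) \<le> \<bar>c\<bar> * B * N\<^sup>2" by simp
    have "coord1 x * ((u, v) \<bullet> (p - (x, y))) = (coord1 x *\<^sub>R u) \<bullet> a + coord1 x * (v \<bullet> b)"
      using ux vy by (simp add: ab inner_diff_right algebra_simps)
    also have "\<dots> = c * (reflect x \<bullet> a) + v \<bullet> (coord1 x *\<^sub>R b - coord1 y *\<^sub>R reflect a)"
      unfolding u by (simp add: inner_diff_left inner_diff_right reflect_inner)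
    also have "\<dots> \<le> (\<bar>c\<bar> * B + 2 * norm v) * N\<^sup>2" using 1 2 by (simp add: algebra_simps)
    finally have "(u, v) \<bullet> (p - (x, y)) \<le> (\<bar>c\<bar> * B + 2 * norm v) / coord1 x * N\<^sup>2"
      using pos by (simp add: field_simps)
    also have "\<dots> \<le> M * N\<^sup>2" unfolding M_def by (intro mult_right_mono) auto
    finally show ?thesis by (simp add: N_def)
  qed
  moreover have "M > 0" unfolding M_def using B pos by (intro add_nonneg_pos) auto
  ultimately show ?thesis unfolding proximal_normal_cone_def by blast
qed

section \<open>Exchanging the two arguments\<close>

lemma swap_in_soc_compl [simp]: "prod.swap p \<in> soc_compl \<longleftrightarrow> p \<in> soc_compl"
  by (cases p) (simp add: soc_compl_swap)

lemma soc_compl_all_swap: "(\<forall>p\<in>soc_compl. P p) \<longleftrightarrow> (\<forall>p\<in>soc_compl. P (prod.swap p))"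
  by (metis swap_in_soc_compl swap_swap)

lemma proximal_normal_swap:
  "(v, u) \<in> proximal_normal_cone soc_compl (y, x) \<longleftrightarrow>
   (u, v) \<in> proximal_normal_cone soc_compl (x, y)"
proof -
  have "(\<forall>p\<in>soc_compl. (v, u) \<bullet> (p - (y, x)) \<le> M * (norm (p - (y, x)))\<^sup>2) \<longleftrightarrow>
      (\<forall>p\<in>soc_compl. (u, v) \<bullet> (p - (x, y)) \<le> M * (norm (p - (x, y)))\<^sup>2)" for M
    by (subst soc_compl_all_swap) (auto simp: norm_Pair add.commute)
  then show ?thesis by (simp add: proximal_normal_cone_def)
qed

lemma regular_normal_swap:
  "(v, u) \<in> regular_normal_cone soc_compl (y, x) \<longleftrightarrow>
   (u, v) \<in> regular_normal_cone soc_compl (x, y)"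
proof -
  have "(\<forall>p\<in>soc_compl. (v, u) \<bullet> (p - (y, x)) \<le> r (norm (p - (y, x)))) \<longleftrightarrow>
      (\<forall>p\<in>soc_compl. (u, v) \<bullet> (p - (x, y)) \<le> r (norm (p - (x, y))))" for r :: "real \<Rightarrow> real"
    by (subst soc_compl_all_swap) (auto simp: norm_Pair add.commute)
  then show ?thesis by (simp add: regular_normal_cone_def)
qed

lemma limiting_normal_swap_imp:
  assumes "(u, v) \<in> limiting_normal_cone soc_compl (x, y)"
  shows "(v, u) \<in> limiting_normal_cone soc_compl (y, x)"
proof -
  obtain q p where qp: "\<And>i::nat. p i \<in> soc_compl \<and> q i \<in> proximal_normal_cone soc_compl (p i)"
      "p \<longlonglongrightarrow> (x, y)" "q \<longlonglongrightarrow> (u, v)"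
    using assms by (auto simp: limiting_normal_cone_def)
  have "prod.swap (q i) \<in> proximal_normal_cone soc_compl (prod.swap (p i))" for i
    using qp(1)[of i] by (cases "p i"; cases "q i") (simp add: proximal_normal_swap)
  moreover have "(\<lambda>i. prod.swap (p i)) \<longlonglongrightarrow> (y, x)" "(\<lambda>i. prod.swap (q i)) \<longlonglongrightarrow> (v, u)"
    using tendsto_Pair[OF tendsto_snd[OF qp(2)] tendsto_fst[OF qp(2)]]
      tendsto_Pair[OF tendsto_snd[OF qp(3)] tendsto_fst[OF qp(3)]]
    by (simp_all add: prod.swap_def)
  ultimately show ?thesis
    unfolding limiting_normal_cone_def using qp(1)
    by (intro CollectI exI[of _ "\<lambda>i. prod.swap (q i)"] exI[of _ "\<lambda>i. prod.swap (p i)"]) auto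
qed

lemma limiting_normal_swap:
  "(v, u) \<in> limiting_normal_cone soc_compl (y, x) \<longleftrightarrow>
   (u, v) \<in> limiting_normal_cone soc_compl (x, y)"
  using limiting_normal_swap_imp by blast

section \<open>Lines, rays and the directions of the cone\<close>

text \<open>Unlike the existence of a factor, this equation is visibly closed in the pair \<open>(p, q)\<close>; all limit
  arguments below use membership in a line or ray in this form.\<close>

lemma line_of_iff: 
  assumes "q \<noteq> 0" shows "p \<in> line_of q \<longleftrightarrow> (q \<bullet> q) *\<^sub>R p = (p \<bullet> q) *\<^sub>R q"
proof
  assume "(q \<bullet> q) *\<^sub>R p = (p \<bullet> q) *\<^sub>R q"
  then have "(1 / (q \<bullet> q)) *\<^sub>R (q \<bullet> q) *\<^sub>R p = (1 / (q \<bullet> q)) *\<^sub>R (p \<bullet> q) *\<^sub>R q" by simp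
  then have "p = (p \<bullet> q / (q \<bullet> q)) *\<^sub>R q" using assms by simp
  then show "p \<in> line_of q" unfolding line_of_def by blast
qed (auto simp: line_of_def)

lemma neg_ray_iff: 
  assumes "q \<noteq> 0" shows "p \<in> neg_ray q \<longleftrightarrow> p \<in> line_of q \<and> p \<bullet> q \<le> 0"
proof -
  have "0 < q \<bullet> q" using assms by simp
  then have "t * (q \<bullet> q) \<le> 0 \<longleftrightarrow> t \<le> 0" for t
    using mult_le_cancel_right_pos[of "q \<bullet> q" t 0] by (simp only: mult_zero_left)
  then have "(t *\<^sub>R q) \<bullet> q \<le> 0 \<longleftrightarrow> t \<le> 0" for t by (simp only: inner_scaleR_left)
  then show ?thesis unfolding neg_ray_def line_of_def mem_Collect_eq by metis
qed

lemma soc_directions_iff: "\<xi> \<in> soc_directions \<longleftrightarrow> coord1 \<xi> = 1 \<and> \<xi> \<in> frontier soc"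
proof -
  have "norm (coord2 \<xi>) = 1 \<longleftrightarrow> (norm (coord2 \<xi>))\<^sup>2 = 1" by (simp add: abs_square_eq_1)
  then show ?thesis
    unfolding soc_directions_def mem_Collect_eq norm_coord2
    by (auto simp: frontier_soc inner_reflect)
qed

lemma soc_directionsD:
  assumes "\<xi> \<in> soc_directions"
  shows "coord1 \<xi> = 1" "\<xi> \<in> frontier soc" "\<xi> \<noteq> 0" "\<xi> \<bullet> reflect \<xi> = 0"
  using assms by (auto simp: soc_directions_iff frontier_soc)

lemma normalized_soc_direction:
  assumes "x \<in> frontier soc" "x \<noteq> 0" shows "(1 / coord1 x) *\<^sub>R x \<in> soc_directions"
  using soc_coord1_pos[OF frontier_subset_soc[OF assms(1)] assms(2)] assms(1)
  by (simp add: soc_directions_iff frontier_soc)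

lemma reflect_frontier [simp]: "reflect x \<in> frontier soc \<longleftrightarrow> x \<in> frontier soc"
  by (simp add: frontier_soc reflect_inner)

lemma reflect_soc_directions [simp]: "reflect \<xi> \<in> soc_directions \<longleftrightarrow> \<xi> \<in> soc_directions"
  by (simp add: soc_directions_iff)

lemma compact_soc_directions: "compact soc_directions"
proof -
  have "soc_directions = {\<xi>. coord1 \<xi> = 1 \<and> \<xi> \<bullet> reflect \<xi> = 0}"
    by (auto simp: soc_directions_iff frontier_soc)
  also have "closed \<dots>"
    by (intro closed_Collect_conj closed_Collect_eq continuous_intros)
  finally have "closed (soc_directions :: (real ^ 'a::{finite,linorder}) set)" .
  moreover have "\<xi> \<bullet> \<xi> = 2" if "\<xi> \<in> soc_directions" for \<xi> :: "real ^ 'a::{finite,linorder}"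
    using soc_directionsD[OF that] by (simp add: inner_reflect)
  then have "bounded (soc_directions :: (real ^ 'a::{finite,linorder}) set)"
    by (intro boundedI[of _ "sqrt 2"]) (simp add: norm_eq_sqrt_inner)
  ultimately show ?thesis by (simp add: compact_eq_bounded_closed)
qed

lemma closed_Collect_Bex:
  fixes P Q :: "'a::euclidean_space \<Rightarrow> 'b::euclidean_space \<Rightarrow> bool"
  assumes "compact S" "closed {p. Q (fst p) (snd p)}" "\<And>x y. x \<in> S \<Longrightarrow> P x y = Q x y"
  shows "closed {y. \<exists>x\<in>S. P x y}"
proof -
  from closed_compact_projection[OF assms(1,2)]
  show ?thesis by (rule back_subst[of closed]) (use assms(3) in auto)
qed

section \<open>Limiting normals away from the origin\<close>

lemma limiting_normal_apex_interior:
  fixes y :: "real ^ 'm::{finite,linorder}"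
  assumes y: "y \<in> interior soc"
  shows "limiting_normal_cone soc_compl (0, y) = {(u, v). v = 0}"
    and "regular_normal_cone soc_compl (0, y) = {(u, v). v = 0}"
proof -
  have z: "(0, y) \<in> soc_compl" using y interior_subset by (auto simp: soc_compl_iff)
  have sup: "{(u, v). v = 0} \<subseteq> proximal_normal_cone soc_compl (0, y)"
    using proximal_normal_apex_interior[OF y] by auto
  show "regular_normal_cone soc_compl (0, y) = {(u, v). v = 0}"
  proof
    show "regular_normal_cone soc_compl (0, y) \<subseteq> {(u, v). v = 0}"
      using regular_normal_apex_interior[OF y] by auto
    show "{(u, v). v = 0} \<subseteq> regular_normal_cone soc_compl (0, y)"
      using sup proximal_subset_regular by blast
  qed
  show "limiting_normal_cone soc_compl (0, y) = {(u, v). v = 0}"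
  proof
    show "{(u, v). v = 0} \<subseteq> limiting_normal_cone soc_compl (0, y)"
      using sup proximal_subset_limiting[OF z] by blast
    show "limiting_normal_cone soc_compl (0, y) \<subseteq> {(u, v). v = 0}"
    proof
      fix w assume w: "w \<in> limiting_normal_cone soc_compl (0, y)"
      let ?U = "UNIV \<times> interior soc :: ((real ^ 'm::{finite,linorder}) \<times> (real ^ 'm::{finite,linorder})) set"
      let ?G = "{p :: ((real ^ 'm::{finite,linorder}) \<times> (real ^ 'm::{finite,linorder})) \<times>
        ((real ^ 'm::{finite,linorder}) \<times> (real ^ 'm::{finite,linorder})). snd (snd p) = 0}"
      have "((0, y), w) \<in> ?G"
      proof (rule limiting_normal_closed_graph[OF w, where U = ?U])
        show "open ?U" by (intro open_Times) auto
        show "closed ?G" by (intro closed_Collect_eq continuous_intros)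
        fix p q assume "p \<in> soc_compl" "p \<in> ?U"
          "q \<in> proximal_normal_cone soc_compl p"
        then show "(p, q) \<in> ?G"
          using proximal_subset_regular soc_compl_interior
          by (cases p; cases q) (fastforce dest: regular_normal_apex_interior)
      qed (use y in auto)
      then show "w \<in> {(u, v). v = 0}" by auto
    qed
  qed
qed

text \<open>Near a point with two nonzero components there are only points of the same kind, so limits of
  normals satisfy the same closed conditions.\<close>

lemma limiting_normal_smooth:
  fixes x y :: "real ^ 'm::{finite,linorder}"
  assumes z: "(x, y) \<in> soc_compl" and x: "x \<noteq> 0" and y: "y \<noteq> 0"
  defines "N \<equiv> {(u, v). orthogonal u x \<and> orthogonal v y \<and>
                   coord1 x *\<^sub>R reflect u + coord1 y *\<^sub>R v \<in> line_of x}"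
  shows "limiting_normal_cone soc_compl (x, y) = N" "regular_normal_cone soc_compl (x, y) = N"
proof -
  have reg: "(u, v) \<in> regular_normal_cone soc_compl (a, b) \<Longrightarrow>
      u \<bullet> a = 0 \<and> v \<bullet> b = 0 \<and> coord1 a *\<^sub>R reflect u + coord1 b *\<^sub>R v \<in> line_of a"
    if "(a, b) \<in> soc_compl" "a \<noteq> 0" "b \<noteq> 0" for a b u v :: "real ^ 'm::{finite,linorder}"
    using regular_normal_smooth[OF that, of u v] by (simp add: line_of_def)
  have sup: "N \<subseteq> proximal_normal_cone soc_compl (x, y)"
    using proximal_normal_smooth[OF z x y] by (auto simp: N_def line_of_def orthogonal_def)
  show "regular_normal_cone soc_compl (x, y) = N"
  proof
    show "regular_normal_cone soc_compl (x, y) \<subseteq> N"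
      using reg[OF z x y] by (auto simp: N_def orthogonal_def)
    show "N \<subseteq> regular_normal_cone soc_compl (x, y)"
      using sup proximal_subset_regular by blast
  qed
  show "limiting_normal_cone soc_compl (x, y) = N"
  proof
    show "N \<subseteq> limiting_normal_cone soc_compl (x, y)"
      using sup proximal_subset_limiting[OF z] by blast
    show "limiting_normal_cone soc_compl (x, y) \<subseteq> N"
    proof
      fix w assume w: "w \<in> limiting_normal_cone soc_compl (x, y)"
      let ?s = "\<lambda>p. coord1 (fst (fst p)) *\<^sub>R reflect (fst (snd p))
        + coord1 (snd (fst p)) *\<^sub>R snd (snd p)"
      let ?G = "{p. fst (snd p) \<bullet> fst (fst p) = 0 \<and> snd (snd p) \<bullet> snd (fst p) = 0 \<and>
        (fst (fst p) \<bullet> fst (fst p)) *\<^sub>R ?s p = (?s p \<bullet> fst (fst p)) *\<^sub>R fst (fst p)}"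
      let ?U = "(- {0}) \<times> (- {0}) :: ((real ^ 'm::{finite,linorder}) \<times> (real ^ 'm::{finite,linorder})) set"
      have "((x, y), w) \<in> ?G"
      proof (rule limiting_normal_closed_graph[OF w, where U = ?U])
        show "open ?U" by (intro open_Times open_Compl) auto
        show "closed ?G" by (intro closed_Collect_conj closed_Collect_eq continuous_intros)
        fix p q assume p: "p \<in> soc_compl" "p \<in> ?U"
          and q: "q \<in> proximal_normal_cone soc_compl p"
        obtain a b u v where [simp]: "p = (a, b)" "q = (u, v)" by (cases p; cases q)
        have "(u, v) \<in> regular_normal_cone soc_compl (a, b)"
          using q proximal_subset_regular by auto
        with reg[of a b u v] p show "(p, q) \<in> ?G"
          by (simp add: line_of_iff)
      qed (use x y in auto)
      then show "w \<in> N" using x by (cases w) (simp add: N_def orthogonal_def line_of_iff)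
    qed
  qed
qed

text \<open>Every neighbourhood of \<open>(0, y)\<close> meets three strata, and each of them contributes one alternative:
  points \<open>(0, b)\<close> with \<open>b\<close> in the interior, points with two nonzero components, and points \<open>(0, b)\<close>
  with \<open>b\<close> on the boundary.  In the limit \<open>x \<longlongrightarrow> 0\<close> the relation of the second stratum loses the
  term with \<open>u\<close> and becomes \<open>y\<^sub>1 v \<in> line_of (reflect y)\<close>.\<close>

lemma limiting_normal_apex_frontier:
  fixes y :: "real ^ 'm::{finite,linorder}"
  assumes y: "y \<in> frontier soc" "y \<noteq> 0"
  shows "limiting_normal_cone soc_compl (0, y) =
    {(u, v). v = 0 \<or> (orthogonal u (reflect y) \<and> v \<in> line_of (reflect y)) \<or>
             (u \<bullet> reflect y \<le> 0 \<and> v \<in> neg_ray (reflect y))}" (is "_ = ?N")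
proof
  have ys: "y \<in> soc" using y frontier_subset_soc by blast
  have y1: "0 < coord1 y" using soc_coord1_pos[OF ys y(2)] .
  have z: "(0, y) \<in> soc_compl" using ys by (simp add: soc_compl_iff)
  show "limiting_normal_cone soc_compl (0, y) \<subseteq> ?N"
  proof
    fix w assume w: "w \<in> limiting_normal_cone soc_compl (0, y)"
    let ?y = "\<lambda>p. reflect (snd (fst p))"
    let ?s = "\<lambda>p. coord1 (fst (fst p)) *\<^sub>R reflect (fst (snd p))
      + coord1 (snd (fst p)) *\<^sub>R snd (snd p)"
    let ?G = "{p. snd (snd p) = 0 \<or>
      (fst (snd p) \<bullet> ?y p = 0 \<and> (?y p \<bullet> ?y p) *\<^sub>R ?s p = (?s p \<bullet> ?y p) *\<^sub>R ?y p) \<or>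
      (fst (snd p) \<bullet> ?y p \<le> 0 \<and> (?y p \<bullet> ?y p) *\<^sub>R snd (snd p) = (snd (snd p) \<bullet> ?y p) *\<^sub>R ?y p
        \<and> snd (snd p) \<bullet> ?y p \<le> 0)}"
    let ?U = "UNIV \<times> (- {0}) :: ((real ^ 'm::{finite,linorder}) \<times> (real ^ 'm::{finite,linorder})) set"
    have "((0 :: real ^ 'm::{finite,linorder}, y), w) \<in> ?G"
    proof (rule limiting_normal_closed_graph[OF w, where U = ?U])
      show "open ?U" by (intro open_Times open_Compl) auto
      show "closed ?G"
        by (intro closed_Collect_disj closed_Collect_conj closed_Collect_eq closed_Collect_le
            continuous_intros)
      fix p q assume p: "p \<in> soc_compl" "p \<in> ?U"
        and q: "q \<in> proximal_normal_cone soc_compl p"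
      obtain a b u v where pq [simp]: "p = (a, b)" "q = (u, v)" by (cases p; cases q)
      have ab: "(a, b) \<in> soc_compl" "b \<noteq> 0" using p by auto
      have reg: "(u, v) \<in> regular_normal_cone soc_compl (a, b)"
        using q proximal_subset_regular by auto
      consider "a \<noteq> 0" | "a = 0" "b \<in> interior soc" | "a = 0" "b \<in> frontier soc"
        using ab interior_subset closure_subset by (fastforce simp: frontier_def soc_compl_iff)
      then show "(p, q) \<in> ?G"
      proof cases
        case 1
        obtain c where c: "coord1 a *\<^sub>R reflect u + coord1 b *\<^sub>R v = c *\<^sub>R a"
          using regular_normal_smooth(3)[OF ab(1) 1 ab(2) reg] by blast
        define k where "k = coord1 a / coord1 b"
        have k: "a = k *\<^sub>R reflect b" unfolding k_def by (rule soc_compl_ray[OF ab])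
        with 1 have "k \<noteq> 0" by auto
        then have "u \<bullet> reflect b = 0"
          using regular_normal_smooth(1)[OF ab(1) 1 ab(2) reg] k by simp
        moreover have "coord1 a *\<^sub>R reflect u + coord1 b *\<^sub>R v \<in> line_of (reflect b)"
          unfolding c using k by (auto simp: line_of_def)
        ultimately show ?thesis
          using ab(2) line_of_iff[of "reflect b"] by simp
      next
        case 2
        then show ?thesis using regular_normal_apex_interior reg by auto
      next
        case 3
        then have "u \<bullet> reflect b \<le> 0" "v \<in> neg_ray (reflect b)"
          using regular_normal_apex_frontier[of b u v] reg ab(2) by (auto simp: neg_ray_def)
        then show ?thesis using ab(2) by (simp add: neg_ray_iff line_of_iff)
      qed
    qed (use y in auto)
    moreover have "(y \<bullet> y * coord1 y) *\<^sub>R v = (coord1 y * (v \<bullet> reflect y)) *\<^sub>R reflect y \<longleftrightarrow>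
        (y \<bullet> y) *\<^sub>R v = (v \<bullet> reflect y) *\<^sub>R reflect y" for v
      using scaleR_cancel_left[of "coord1 y" "(y \<bullet> y) *\<^sub>R v" "(v \<bullet> reflect y) *\<^sub>R reflect y"] y1
      by (simp add: mult.commute)
    ultimately show "w \<in> ?N"
      using y y1 by (cases w) (auto simp: neg_ray_iff line_of_iff orthogonal_def)
  qed
  show "?N \<subseteq> limiting_normal_cone soc_compl (0, y)"
  proof clarify
    fix u v assume "v = 0 \<or> (orthogonal u (reflect y) \<and> v \<in> line_of (reflect y)) \<or>
             (u \<bullet> reflect y \<le> 0 \<and> v \<in> neg_ray (reflect y))"
    then consider "v = 0" | "u \<bullet> reflect y = 0" "v \<in> line_of (reflect y)"
      | "u \<bullet> reflect y \<le> 0" "v \<in> neg_ray (reflect y)"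
      unfolding orthogonal_def by blast
    then show "(u, v) \<in> limiting_normal_cone soc_compl (0, y)"
    proof cases
      case 1
      show ?thesis
      proof (rule limiting_normal_along)
        have "y + t *\<^sub>R axis1 \<in> interior soc" if "0 < t" for t
        proof -
          have "(y + t *\<^sub>R axis1) \<bullet> reflect (y + t *\<^sub>R axis1) = 2 * (t * coord1 y) + t * t"
            using y by (simp add: frontier_soc inner_reflect reflect_eq inner_add_left
                inner_add_right inner_diff_right coord1_inner inner_commute algebra_simps)
          then show ?thesis using that y1 by (simp add: interior_soc add_pos_pos)
        qed
        then have "(0, y + t *\<^sub>R axis1) \<in> soc_compl \<and>
            (u, 0) \<in> proximal_normal_cone soc_compl (0, y + t *\<^sub>R axis1)" if "0 < t" for t
          using proximal_normal_apex_interior that interior_subset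
          by (fastforce simp: soc_compl_iff)
        then show "\<forall>\<^sub>F t in at_right 0. (0, y + t *\<^sub>R axis1) \<in> soc_compl \<and>
            (u, v) \<in> proximal_normal_cone soc_compl (0, y + t *\<^sub>R axis1)"
          using 1 by (auto simp: eventually_at_filter)
        have "((\<lambda>t. (0, y + t *\<^sub>R axis1)) \<longlongrightarrow> (0, y + 0 *\<^sub>R axis1)) (at_right 0)"
          by (intro tendsto_intros)
        then show "((\<lambda>t. (0, y + t *\<^sub>R axis1)) \<longlongrightarrow> (0, y)) (at_right 0)" by simp
      qed simp
    next
      case 2
      then obtain c where c: "v = c *\<^sub>R reflect y" by (auto simp: line_of_def)
      show ?thesis
      proof (rule limiting_normal_along)
        \<comment> \<open>approach along \<open>(t reflect y, y)\<close>; the correction of \<open>v\<close> cancels the term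
          \<open>x\<^sub>1 reflect u\<close> in the relation of the smooth stratum\<close>
        have yy: "reflect y \<bullet> y = 0" using y by (simp add: frontier_soc reflect_inner)
        have "(t *\<^sub>R reflect y, y) \<in> soc_compl \<and>
            (u, v - t *\<^sub>R reflect u) \<in> proximal_normal_cone soc_compl (t *\<^sub>R reflect y, y)"
          if t: "0 < t" for t
        proof
          show z: "(t *\<^sub>R reflect y, y) \<in> soc_compl" using frontier_soc_pair[OF y(1)] t by simp
          show "(u, v - t *\<^sub>R reflect u) \<in> proximal_normal_cone soc_compl (t *\<^sub>R reflect y, y)"
            by (rule proximal_normal_smooth[OF z, where c = "coord1 y * c / t"])
               (use t y 2 yy in \<open>simp_all add: c algebra_simps inner_diff_left reflect_inner\<close>)
        qed
        then show "\<forall>\<^sub>F t in at_right 0. (t *\<^sub>R reflect y, y) \<in> soc_compl \<and>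
            (u, v - t *\<^sub>R reflect u) \<in> proximal_normal_cone soc_compl (t *\<^sub>R reflect y, y)"
          by (auto simp: eventually_at_filter)
        have "((\<lambda>t. (t *\<^sub>R reflect y, y)) \<longlongrightarrow> (0 *\<^sub>R reflect y, y)) (at_right 0)"
          "((\<lambda>t. (u, v - t *\<^sub>R reflect u)) \<longlongrightarrow> (u, v - 0 *\<^sub>R reflect u)) (at_right 0)"
          by (intro tendsto_intros)+
        then show "((\<lambda>t. (t *\<^sub>R reflect y, y)) \<longlongrightarrow> (0, y)) (at_right 0)"
          "((\<lambda>t. (u, v - t *\<^sub>R reflect u)) \<longlongrightarrow> (u, v)) (at_right 0)"
          by simp_all
      qed
    next
      case 3
      then have "(u, v) \<in> proximal_normal_cone soc_compl (0, y)"
        using proximal_normal_apex_frontier[OF y] by (auto simp: neg_ray_def)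
      then show ?thesis using proximal_subset_limiting[OF z] by blast
    qed
  qed
qed

section \<open>Limiting normals at the origin\<close>

definition origin_normals ::
    "((real ^ 'm::{finite,linorder}) \<times> (real ^ 'm::{finite,linorder})) set" where
  "origin_normals =
    {(u, v). (u \<in> uminus ` soc \<and> v \<in> uminus ` soc) \<or>
             v = 0 \<or>
             u = 0 \<or>
             (\<exists>\<xi>\<in>soc_directions. u \<in> neg_ray \<xi> \<and> v \<in> polar_of \<xi>) \<or>
             (\<exists>\<xi>\<in>soc_directions. u \<in> polar_of \<xi> \<and> v \<in> neg_ray \<xi>) \<or>
             (\<exists>\<alpha>\<in>{0..1}. \<exists>\<xi>\<in>soc_directions.
                orthogonal u \<xi> \<and> orthogonal v (reflect \<xi>) \<and>
                \<alpha> *\<^sub>R reflect u + (1 - \<alpha>) *\<^sub>R v \<in> line_of \<xi>)}"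

text \<open>The parameters \<open>\<xi>\<close> and \<open>\<alpha>\<close> range over compact sets, and projecting a closed set along a compact
  factor gives a closed set.\<close>

lemma closed_origin_normals:
  "closed (origin_normals :: ((real ^ 'm::{finite,linorder}) \<times> (real ^ 'm::{finite,linorder})) set)"
proof -
  let ?C = "soc_directions :: (real ^ 'm::{finite,linorder}) set"
  let ?A = "(uminus ` soc) \<times> (uminus ` soc) ::
    ((real ^ 'm::{finite,linorder}) \<times> (real ^ 'm::{finite,linorder})) set"
  let ?B = "{w :: (real ^ 'm::{finite,linorder}) \<times> (real ^ 'm::{finite,linorder}).
    snd w = 0 \<or> fst w = 0}"
  let ?D = "{w. \<exists>\<xi>\<in>?C. fst w \<in> neg_ray \<xi> \<and> snd w \<in> polar_of \<xi>}"
  let ?E = "{w. \<exists>\<xi>\<in>?C. fst w \<in> polar_of \<xi> \<and> snd w \<in> neg_ray \<xi>}"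
  let ?s = "\<lambda>a w. fst a *\<^sub>R reflect (fst w) + (1 - fst a) *\<^sub>R snd w"
  let ?F = "{w. \<exists>a\<in>{0..1} \<times> ?C. fst w \<bullet> snd a = 0 \<and> snd w \<bullet> reflect (snd a) = 0 \<and>
    ?s a w \<in> line_of (snd a)}"
  have "closed ?A" by (intro closed_Times closed_negations closed_soc)
  moreover have "closed ?B"
    by (intro closed_Collect_disj closed_Collect_eq continuous_intros)
  moreover have "closed ?D"
  proof (rule closed_Collect_Bex[OF compact_soc_directions])
    show "closed {p :: (real ^ 'm::{finite,linorder}) \<times>
        (real ^ 'm::{finite,linorder}) \<times> (real ^ 'm::{finite,linorder}).
      ((fst p \<bullet> fst p) *\<^sub>R fst (snd p) = (fst (snd p) \<bullet> fst p) *\<^sub>R fst p \<and>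
        fst (snd p) \<bullet> fst p \<le> 0) \<and> snd (snd p) \<bullet> fst p \<le> 0}"
      by (intro closed_Collect_conj closed_Collect_eq closed_Collect_le continuous_intros)
  qed (simp add: neg_ray_iff line_of_iff polar_of_def soc_directionsD(3))
  moreover have "closed ?E"
  proof (rule closed_Collect_Bex[OF compact_soc_directions])
    show "closed {p :: (real ^ 'm::{finite,linorder}) \<times>
        (real ^ 'm::{finite,linorder}) \<times> (real ^ 'm::{finite,linorder}).
      fst (snd p) \<bullet> fst p \<le> 0 \<and>
      ((fst p \<bullet> fst p) *\<^sub>R snd (snd p) = (snd (snd p) \<bullet> fst p) *\<^sub>R fst p \<and>
        snd (snd p) \<bullet> fst p \<le> 0)}"
      by (intro closed_Collect_conj closed_Collect_eq closed_Collect_le continuous_intros)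
  qed (simp add: neg_ray_iff line_of_iff polar_of_def soc_directionsD(3))
  moreover have "closed ?F"
  proof (rule closed_Collect_Bex)
    show "compact ({0..1::real} \<times> ?C)" by (intro compact_Times compact_soc_directions compact_Icc)
    show "closed {p :: (real \<times> (real ^ 'm::{finite,linorder})) \<times>
        (real ^ 'm::{finite,linorder}) \<times> (real ^ 'm::{finite,linorder}).
      fst (snd p) \<bullet> snd (fst p) = 0 \<and> snd (snd p) \<bullet> reflect (snd (fst p)) = 0 \<and>
      (snd (fst p) \<bullet> snd (fst p)) *\<^sub>R ?s (fst p) (snd p) = (?s (fst p) (snd p) \<bullet> snd (fst p)) *\<^sub>R snd (fst p)}"
      by (intro closed_Collect_conj closed_Collect_eq continuous_intros)
    fix a :: "real \<times> (real ^ 'm::{finite,linorder})"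
      and w :: "(real ^ 'm::{finite,linorder}) \<times> (real ^ 'm::{finite,linorder})"
    assume "a \<in> {0..1::real} \<times> ?C"
    then have "snd a \<noteq> 0" by (auto dest: soc_directionsD(3))
    then show "(fst w \<bullet> snd a = 0 \<and> snd w \<bullet> reflect (snd a) = 0 \<and> ?s a w \<in> line_of (snd a)) =
      (fst w \<bullet> snd a = 0 \<and> snd w \<bullet> reflect (snd a) = 0 \<and>
        (snd a \<bullet> snd a) *\<^sub>R ?s a w = (?s a w \<bullet> snd a) *\<^sub>R snd a)"
      by (simp only: line_of_iff not_False_eq_True)
  qed
  ultimately have "closed (?A \<union> (?B \<union> (?D \<union> (?E \<union> ?F))))" by (intro closed_Un)
  moreover have "?A \<union> (?B \<union> (?D \<union> (?E \<union> ?F))) = origin_normals"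
    unfolding set_eq_iff origin_normals_def orthogonal_def by (simp add: split_paired_all)
  ultimately show ?thesis by simp
qed

lemma regular_normal_in_origin_normals_apex:
  assumes y: "y \<in> soc" "y \<noteq> 0" and w: "(u, v) \<in> regular_normal_cone soc_compl (0, y)"
  shows "v = 0 \<or> (\<exists>\<xi>\<in>soc_directions. u \<in> polar_of \<xi> \<and> v \<in> neg_ray \<xi>)"
proof (cases "y \<in> interior soc")
  case True
  then show ?thesis using regular_normal_apex_interior w by blast
next
  case False
  then have yf: "y \<in> frontier soc" using y closure_subset by (auto simp: frontier_def)
  have y1: "0 < coord1 y" using soc_coord1_pos[OF y] .
  obtain c where c: "c \<le> 0" "v = c *\<^sub>R reflect y" and u: "u \<bullet> reflect y \<le> 0"
    using regular_normal_apex_frontier[OF yf y(2) w] by blast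
  let ?\<xi> = "(1 / coord1 (reflect y)) *\<^sub>R reflect y"
  have "?\<xi> \<in> soc_directions" using yf y by (intro normalized_soc_direction) auto
  moreover have "u \<in> polar_of ?\<xi>"
    using u y1 by (simp add: polar_of_def divide_nonpos_pos)
  moreover have "v = (c * coord1 y) *\<^sub>R ?\<xi>" "c * coord1 y \<le> 0"
    using c y1 by (auto intro: mult_nonpos_nonneg)
  then have "v \<in> neg_ray ?\<xi>" unfolding neg_ray_def by blast
  ultimately show ?thesis by blast
qed

text \<open>The normals of every stratum satisfy one of the conditions at the origin: scaling a boundary
  component or its reflection to \<open>\<xi>\<close> and the pair \<open>(x\<^sub>1, y\<^sub>1)\<close> to \<open>(\<alpha>, 1 - \<alpha>)\<close> removes the base point from them.\<close>

lemma regular_normal_in_origin_normals: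
  assumes z: "(x, y) \<in> soc_compl" and w: "(u, v) \<in> regular_normal_cone soc_compl (x, y)"
  shows "(u, v) \<in> origin_normals"
proof -
  have s: "x \<in> soc" "y \<in> soc" using z by (auto simp: soc_compl_iff)
  consider "x = 0" "y = 0" | "x = 0" "y \<noteq> 0" | "x \<noteq> 0" "y = 0" | "x \<noteq> 0" "y \<noteq> 0" by blast
  then show ?thesis
  proof cases
    case 1
    have "- v \<in> soc" "- u \<in> soc"
      using regular_normal_apex(1)[of 0 u v] regular_normal_apex(1)[of 0 v u] w 1
      by (simp_all add: regular_normal_swap)
    then have "u \<in> uminus ` soc" "v \<in> uminus ` soc" by (metis image_eqI minus_minus)+
    then show ?thesis by (simp add: origin_normals_def)
  next
    case 2
    then show ?thesis using regular_normal_in_origin_normals_apex[of y u v] w s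
      unfolding origin_normals_def by blast
  next
    case 3
    have "(v, u) \<in> regular_normal_cone soc_compl (0, x)"
      using w 3 by (simp add: regular_normal_swap)
    then show ?thesis using regular_normal_in_origin_normals_apex[of x v u] s 3
      unfolding origin_normals_def by blast
  next
    case 4
    have pos: "0 < coord1 x" "0 < coord1 y" using soc_coord1_pos s 4 by auto
    note n = regular_normal_smooth[OF z 4 w]
    obtain c where c: "coord1 x *\<^sub>R reflect u + coord1 y *\<^sub>R v = c *\<^sub>R x" using n(3) by blast
    define k where "k = coord1 x + coord1 y"
    have k: "k > 0" using pos by (simp add: k_def)
    have xf: "x \<in> frontier soc" by (rule soc_compl_frontier[OF z 4(2)])
    let ?\<xi> = "(1 / coord1 x) *\<^sub>R x" and ?\<alpha> = "coord1 x / k"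
    have "reflect x = (coord1 x / coord1 y) *\<^sub>R y"
      by (metis soc_compl_ray[OF z 4(2)] reflect_linear(5) reflect_reflect)
    then have "v \<bullet> reflect x = 0" using n(2) by simp
    then have "orthogonal u ?\<xi>" "orthogonal v (reflect ?\<xi>)"
      using n(1) by (simp_all add: orthogonal_def)
    moreover have \<alpha>: "1 - ?\<alpha> = coord1 y / k" using k by (simp add: k_def field_simps)
    have "?\<alpha> *\<^sub>R reflect u + (1 - ?\<alpha>) *\<^sub>R v
        = (1 / k) *\<^sub>R (coord1 x *\<^sub>R reflect u + coord1 y *\<^sub>R v)"
      unfolding \<alpha> by (simp add: scaleR_add_right)
    then have "?\<alpha> *\<^sub>R reflect u + (1 - ?\<alpha>) *\<^sub>R v = (c * coord1 x / k) *\<^sub>R ?\<xi>"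
      unfolding c using pos by simp
    then have "?\<alpha> *\<^sub>R reflect u + (1 - ?\<alpha>) *\<^sub>R v \<in> line_of ?\<xi>" unfolding line_of_def by blast
    moreover have "?\<alpha> \<in> {0..1}" using pos k by (simp add: k_def)
    moreover have "?\<xi> \<in> soc_directions" by (rule normalized_soc_direction[OF xf 4(1)])
    ultimately show ?thesis unfolding origin_normals_def by blast
  qed
qed


lemma limiting_normal_origin_free:
  fixes u :: "real ^ 'm::{finite,linorder}"
  shows "(u, 0) \<in> limiting_normal_cone soc_compl (0, 0)"
proof (rule limiting_normal_along)
  have "t *\<^sub>R axis1 \<in> interior (soc :: (real ^ 'm::{finite,linorder}) set)" if "0 < t" for t
    using that by (simp add: interior_soc inner_reflect)
  then have "(0 :: real ^ 'm::{finite,linorder}, t *\<^sub>R axis1) \<in> soc_compl \<and>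
      (u, 0) \<in> proximal_normal_cone soc_compl (0, t *\<^sub>R axis1)" if "0 < t" for t
    using that by (simp add: soc_compl_iff soc_scaleR proximal_normal_apex_interior)
  then show "\<forall>\<^sub>F t in at_right 0. (0 :: real ^ 'm::{finite,linorder}, t *\<^sub>R axis1) \<in> soc_compl \<and>
      (u, 0) \<in> proximal_normal_cone soc_compl (0, t *\<^sub>R axis1)"
    by (auto simp: eventually_at_filter)
  have "((\<lambda>t. (0 :: real ^ 'm::{finite,linorder}, t *\<^sub>R axis1 :: real ^ 'm::{finite,linorder}))
      \<longlongrightarrow> (0, 0 *\<^sub>R axis1)) (at_right 0)"
    by (intro tendsto_intros)
  then show "((\<lambda>t. (0 :: real ^ 'm::{finite,linorder}, t *\<^sub>R axis1 :: real ^ 'm::{finite,linorder}))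
      \<longlongrightarrow> (0, 0)) (at_right 0)"
    by simp
qed simp


lemma limiting_normal_origin_ray:
  fixes \<xi> u v :: "real ^ 'm::{finite,linorder}"
  assumes \<xi>: "\<xi> \<in> soc_directions" and u: "u \<in> polar_of \<xi>" and v: "v \<in> neg_ray \<xi>"
  shows "(u, v) \<in> limiting_normal_cone soc_compl (0, 0)"
proof (rule limiting_normal_along)
  obtain c where c: "c \<le> 0" "v = c *\<^sub>R \<xi>" using v by (auto simp: neg_ray_def)
  have "(0, t *\<^sub>R reflect \<xi>) \<in> soc_compl \<and>
      (u, v) \<in> proximal_normal_cone soc_compl (0, t *\<^sub>R reflect \<xi>)" if t: "0 < t" for t
  proof
    have f: "t *\<^sub>R reflect \<xi> \<in> frontier soc" "t *\<^sub>R reflect \<xi> \<noteq> 0"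
      using soc_directionsD[OF \<xi>] t by (simp_all add: frontier_soc reflect_inner)
    then show "(0, t *\<^sub>R reflect \<xi>) \<in> soc_compl"
      using frontier_subset_soc by (simp add: soc_compl_iff)
    have "u \<bullet> reflect (t *\<^sub>R reflect \<xi>) \<le> 0"
      using u t by (simp add: polar_of_def mult_nonneg_nonpos)
    moreover have "c / t \<le> 0" using c t by (simp add: divide_nonpos_pos)
    ultimately show "(u, v) \<in> proximal_normal_cone soc_compl (0, t *\<^sub>R reflect \<xi>)"
      using proximal_normal_apex_frontier[OF f, of u "c / t"] t by (simp add: c)
  qed
  then show "\<forall>\<^sub>F t in at_right 0. (0, t *\<^sub>R reflect \<xi>) \<in> soc_compl \<and>
      (u, v) \<in> proximal_normal_cone soc_compl (0, t *\<^sub>R reflect \<xi>)"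
    by (auto simp: eventually_at_filter)
  have "((\<lambda>t. (0 :: real ^ 'm::{finite,linorder}, t *\<^sub>R reflect \<xi>)) \<longlongrightarrow> (0, 0 *\<^sub>R reflect \<xi>)) (at_right 0)"
    by (intro tendsto_intros)
  then show "((\<lambda>t. (0 :: real ^ 'm::{finite,linorder}, t *\<^sub>R reflect \<xi>)) \<longlongrightarrow> (0, 0)) (at_right 0)"
    by simp
qed simp

text \<open>The base points \<open>(t \<alpha> \<xi>, t (1 - \<alpha>) reflect \<xi>)\<close> have two nonzero components only if \<open>0 < \<alpha>\<close>.  To
  include \<open>\<alpha> = 0\<close>, the weight is moved into the open unit interval as \<open>A t\<close>, and \<open>v\<close> is changed to
  \<open>V t\<close> so that the combination \<open>A t reflect u + (1 - A t) V t\<close> stays equal to \<open>\<tau> \<xi>\<close>.\<close>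

lemma limiting_normal_origin_smooth_lt_1:
  assumes \<xi>: "\<xi> \<in> soc_directions" and a: "0 \<le> \<alpha>" "\<alpha> < 1"
    and u: "orthogonal u \<xi>" and v: "orthogonal v (reflect \<xi>)"
    and line: "\<alpha> *\<^sub>R reflect u + (1 - \<alpha>) *\<^sub>R v \<in> line_of \<xi>"
  shows "(u, v) \<in> limiting_normal_cone soc_compl (0, 0)"
proof -
  obtain \<tau> where \<tau>: "\<alpha> *\<^sub>R reflect u + (1 - \<alpha>) *\<^sub>R v = \<tau> *\<^sub>R \<xi>"
    using line by (auto simp: line_of_def)
  define A where "A t = (1 - t) * \<alpha> + t / 2" for t :: real
  define V where "V t = (1 / (1 - A t)) *\<^sub>R (\<tau> *\<^sub>R \<xi> - A t *\<^sub>R reflect u)" for t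
  have "(A \<longlongrightarrow> (1 - 0) * \<alpha> + 0 / 2) (at_right 0)"
    unfolding A_def by (intro tendsto_intros) simp
  then have A: "(A \<longlongrightarrow> \<alpha>) (at_right 0)" by simp
  have "(V \<longlongrightarrow> (1 / (1 - \<alpha>)) *\<^sub>R (\<tau> *\<^sub>R \<xi> - \<alpha> *\<^sub>R reflect u)) (at_right 0)"
    unfolding V_def using a by (intro tendsto_intros A) simp
  moreover have "(1 / (1 - \<alpha>)) *\<^sub>R (\<tau> *\<^sub>R \<xi> - \<alpha> *\<^sub>R reflect u) = v"
    unfolding \<tau>[symmetric] using a by simp
  ultimately have V: "(V \<longlongrightarrow> v) (at_right 0)" by simp
  have A01: "0 < A t \<and> A t < 1" if t: "0 < t" "t < 1" for t
  proof
    show "0 < A t" unfolding A_def using t a by (intro add_nonneg_pos) auto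
    have "(1 - t) * \<alpha> \<le> 1 - t" using t a by (intro mult_left_le) auto
    then show "A t < 1" unfolding A_def using t by linarith
  qed
  show ?thesis
  proof (rule limiting_normal_along)
    have "(t *\<^sub>R A t *\<^sub>R \<xi>, t *\<^sub>R (1 - A t) *\<^sub>R reflect \<xi>) \<in> soc_compl \<and>
      (u, V t) \<in> proximal_normal_cone soc_compl (t *\<^sub>R A t *\<^sub>R \<xi>, t *\<^sub>R (1 - A t) *\<^sub>R reflect \<xi>)"
      if t: "0 < t" "t < 1" for t
    proof
      note \<xi>' = soc_directionsD[OF \<xi>] and A' = A01[OF t]
      have s: "\<xi> \<in> soc" by (rule frontier_subset_soc[OF \<xi>'(2)])
      show z: "(t *\<^sub>R A t *\<^sub>R \<xi>, t *\<^sub>R (1 - A t) *\<^sub>R reflect \<xi>) \<in> soc_compl"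
        unfolding soc_compl_iff using A' t s \<xi>'(4) by (auto intro!: soc_scaleR)
      show "(u, V t) \<in> proximal_normal_cone soc_compl (t *\<^sub>R A t *\<^sub>R \<xi>, t *\<^sub>R (1 - A t) *\<^sub>R reflect \<xi>)"
      proof (rule proximal_normal_smooth[OF z, where c = "\<tau> / A t"])
        show "t *\<^sub>R A t *\<^sub>R \<xi> \<noteq> 0" "t *\<^sub>R (1 - A t) *\<^sub>R reflect \<xi> \<noteq> 0"
          using t A' \<xi>'(3) by simp_all
        show "u \<bullet> (t *\<^sub>R A t *\<^sub>R \<xi>) = 0" using u by (simp add: orthogonal_def)
        show "V t \<bullet> (t *\<^sub>R (1 - A t) *\<^sub>R reflect \<xi>) = 0"
          using u \<xi>'(4) by (simp add: V_def inner_diff_left orthogonal_def)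
        have "coord1 (t *\<^sub>R (1 - A t) *\<^sub>R reflect \<xi>) *\<^sub>R V t = t *\<^sub>R (\<tau> *\<^sub>R \<xi> - A t *\<^sub>R reflect u)"
          using A' \<xi>'(1) by (simp add: V_def)
        then show "coord1 (t *\<^sub>R A t *\<^sub>R \<xi>) *\<^sub>R reflect u + coord1 (t *\<^sub>R (1 - A t) *\<^sub>R reflect \<xi>) *\<^sub>R V t
            = (\<tau> / A t) *\<^sub>R t *\<^sub>R A t *\<^sub>R \<xi>"
          using A' \<xi>'(1) by (simp add: algebra_simps)
      qed
    qed
    then show "\<forall>\<^sub>F t in at_right 0. (t *\<^sub>R A t *\<^sub>R \<xi>, t *\<^sub>R (1 - A t) *\<^sub>R reflect \<xi>) \<in> soc_compl \<and>
      (u, V t) \<in> proximal_normal_cone soc_compl (t *\<^sub>R A t *\<^sub>R \<xi>, t *\<^sub>R (1 - A t) *\<^sub>R reflect \<xi>)"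
      unfolding eventually_at_right[OF zero_less_one] by (intro exI[of _ 1]) auto
    have "((\<lambda>t. (t *\<^sub>R A t *\<^sub>R \<xi>, t *\<^sub>R (1 - A t) *\<^sub>R reflect \<xi>)) \<longlongrightarrow>
        (0 *\<^sub>R \<alpha> *\<^sub>R \<xi>, 0 *\<^sub>R (1 - \<alpha>) *\<^sub>R reflect \<xi>)) (at_right 0)"
      by (intro tendsto_intros A)
    then show "((\<lambda>t. (t *\<^sub>R A t *\<^sub>R \<xi>, t *\<^sub>R (1 - A t) *\<^sub>R reflect \<xi>)) \<longlongrightarrow> (0, 0)) (at_right 0)"
      by simp
    show "((\<lambda>t. (u, V t)) \<longlongrightarrow> (u, v)) (at_right 0)" by (intro tendsto_intros V)
  qed
qed

text \<open>For \<open>\<alpha> = 1\<close>, exchanging \<open>u\<close> with \<open>v\<close> and \<open>\<xi>\<close> with \<open>reflect \<xi>\<close> leads back to \<open>\<alpha> = 0\<close>.\<close>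

lemma limiting_normal_origin_smooth:
  assumes \<xi>: "\<xi> \<in> soc_directions" and a: "0 \<le> \<alpha>" "\<alpha> \<le> 1"
    and u: "orthogonal u \<xi>" and v: "orthogonal v (reflect \<xi>)"
    and line: "\<alpha> *\<^sub>R reflect u + (1 - \<alpha>) *\<^sub>R v \<in> line_of \<xi>"
  shows "(u, v) \<in> limiting_normal_cone soc_compl (0, 0)"
proof (cases "\<alpha> < 1")
  case True
  then show ?thesis using limiting_normal_origin_smooth_lt_1 assms by blast
next
  case False
  with a line have "reflect u \<in> line_of \<xi>" by simp
  then obtain \<tau> where "reflect u = \<tau> *\<^sub>R \<xi>" by (auto simp: line_of_def)
  then have "u = \<tau> *\<^sub>R reflect \<xi>" by (metis reflect_linear(5) reflect_reflect)
  then have "0 *\<^sub>R reflect v + (1 - 0) *\<^sub>R u \<in> line_of (reflect \<xi>)" by (auto simp: line_of_def)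
  then have "(v, u) \<in> limiting_normal_cone soc_compl (0, 0)"
    using \<xi> u v by (intro limiting_normal_origin_smooth_lt_1[of "reflect \<xi>" 0]) auto
  then show ?thesis by (rule limiting_normal_swap_imp)
qed

lemma limiting_normal_origin:
  "limiting_normal_cone soc_compl (0, 0) =
    (origin_normals :: ((real ^ 'm::{finite,linorder}) \<times> (real ^ 'm::{finite,linorder})) set)"
proof
  let ?E = "UNIV :: ((real ^ 'm::{finite,linorder}) \<times> (real ^ 'm::{finite,linorder})) set"
  show "limiting_normal_cone soc_compl (0, 0) \<subseteq>
    (origin_normals :: ((real ^ 'm::{finite,linorder}) \<times> (real ^ 'm::{finite,linorder})) set)"
  proof
    fix w :: "(real ^ 'm::{finite,linorder}) \<times> (real ^ 'm::{finite,linorder})"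
    assume w: "w \<in> limiting_normal_cone soc_compl (0, 0)"
    have "((0, 0), w) \<in> ?E \<times> origin_normals"
    proof (rule limiting_normal_closed_graph[OF w, where U = ?E])
      show "closed (?E \<times> (origin_normals :: ((real ^ 'm::{finite,linorder}) \<times> (real ^ 'm::{finite,linorder})) set))"
        by (intro closed_Times closed_origin_normals) simp
      fix p q :: "(real ^ 'm::{finite,linorder}) \<times> (real ^ 'm::{finite,linorder})"
      assume "p \<in> soc_compl" "q \<in> proximal_normal_cone soc_compl p"
      then have "q \<in> origin_normals"
        using regular_normal_in_origin_normals proximal_subset_regular
        by (cases p; cases q) blast
      then show "(p, q) \<in> ?E \<times> origin_normals" by simp
    qed auto
    then show "w \<in> origin_normals" by simp
  qed
  show "origin_normals \<subseteq> limiting_normal_cone soc_compl (0, 0 :: real ^ 'm::{finite,linorder})"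
  proof clarify
    fix u v :: "real ^ 'm::{finite,linorder}" assume "(u, v) \<in> origin_normals"
    then consider (polar) "u \<in> uminus ` soc" "v \<in> uminus ` soc" | "v = 0" | "u = 0"
      | (ray1) \<xi> where "\<xi> \<in> soc_directions" "u \<in> neg_ray \<xi>" "v \<in> polar_of \<xi>"
      | (ray2) \<xi> where "\<xi> \<in> soc_directions" "u \<in> polar_of \<xi>" "v \<in> neg_ray \<xi>"
      | (smooth) \<alpha> \<xi> where "0 \<le> \<alpha>" "\<alpha> \<le> 1" "\<xi> \<in> soc_directions"
          "orthogonal u \<xi>" "orthogonal v (reflect \<xi>)"
          "\<alpha> *\<^sub>R reflect u + (1 - \<alpha>) *\<^sub>R v \<in> line_of \<xi>"
      unfolding origin_normals_def by auto
    then show "(u, v) \<in> limiting_normal_cone soc_compl (0, 0)"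
    proof cases
      case polar
      then have uv: "- u \<in> soc" "- v \<in> soc" by auto
      have "u \<bullet> a + v \<bullet> b \<le> 0" if "a \<in> soc" "b \<in> soc" for a b
        using soc_inner_nonneg[OF uv(1) that(1)] soc_inner_nonneg[OF uv(2) that(2)] by simp
      then have "(u, v) \<bullet> (p - (0, 0)) \<le> 1 * (norm (p - (0, 0)))\<^sup>2" if "p \<in> soc_compl" for p
        using that by (cases p) (force simp: soc_compl_iff intro: order_trans[OF _ zero_le_power2])
      then have "(u, v) \<in> proximal_normal_cone soc_compl (0, 0)"
        unfolding proximal_normal_cone_def using zero_less_one by blast
      moreover have "(0, 0 :: real ^ 'm::{finite,linorder}) \<in> soc_compl" by (simp add: soc_compl_iff)
      ultimately show ?thesis using proximal_subset_limiting by blast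
    next
      case ray1
      then show ?thesis using limiting_normal_origin_ray limiting_normal_swap by blast
    next
      case smooth
      then show ?thesis using limiting_normal_origin_smooth by blast
    qed (auto intro: limiting_normal_origin_free limiting_normal_origin_ray limiting_normal_swap_imp)
  qed
qed

theorem theorem5p1:
  fixes x y :: "real ^ 'm::{finite,linorder}"
  assumes "(x, y) \<in> soc_compl"
  shows
    "(x = 0 \<and> y \<in> interior soc \<longrightarrow>
        limiting_normal_cone soc_compl (x, y) = regular_normal_cone soc_compl (x, y) \<and>
        limiting_normal_cone soc_compl (x, y) = {(u, v). v = 0}) \<and>
     (x \<in> interior soc \<and> y = 0 \<longrightarrow>
        limiting_normal_cone soc_compl (x, y) = regular_normal_cone soc_compl (x, y) \<and>
        limiting_normal_cone soc_compl (x, y) = {(u, v). u = 0}) \<and>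
     (x \<in> frontier soc - {0} \<and> y \<in> frontier soc - {0} \<longrightarrow>
        limiting_normal_cone soc_compl (x, y) = regular_normal_cone soc_compl (x, y) \<and>
        limiting_normal_cone soc_compl (x, y) =
          {(u, v). orthogonal u x \<and> orthogonal v y \<and>
                   coord1 x *\<^sub>R reflect u + coord1 y *\<^sub>R v \<in> line_of x}) \<and>
     (x = 0 \<and> y \<in> frontier soc - {0} \<longrightarrow>
        limiting_normal_cone soc_compl (x, y) =
          {(u, v). v = 0 \<or>
                   (orthogonal u (reflect y) \<and> v \<in> line_of (reflect y)) \<or>
                   (u \<bullet> reflect y \<le> 0 \<and> v \<in> neg_ray (reflect y))}) \<and>
     (x \<in> frontier soc - {0} \<and> y = 0 \<longrightarrow>
        limiting_normal_cone soc_compl (x, y) =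
          {(u, v). u = 0 \<or>
                   (u \<in> line_of (reflect x) \<and> orthogonal v (reflect x)) \<or>
                   (u \<in> neg_ray (reflect x) \<and> v \<bullet> reflect x \<le> 0)}) \<and>
     (x = 0 \<and> y = 0 \<longrightarrow>
        limiting_normal_cone soc_compl (x, y) =
          {(u, v). (u \<in> uminus ` soc \<and> v \<in> uminus ` soc) \<or>
                   v = 0 \<or>
                   u = 0 \<or>
                   (\<exists>\<xi>\<in>soc_directions. u \<in> neg_ray \<xi> \<and> v \<in> polar_of \<xi>) \<or>
                   (\<exists>\<xi>\<in>soc_directions. u \<in> polar_of \<xi> \<and> v \<in> neg_ray \<xi>) \<or>
                   (\<exists>\<alpha>\<in>{0..1}. \<exists>\<xi>\<in>soc_directions.
                      orthogonal u \<xi> \<and> orthogonal v (reflect \<xi>) \<and>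
                      \<alpha> *\<^sub>R reflect u + (1 - \<alpha>) *\<^sub>R v \<in> line_of \<xi>)})"
proof (intro conjI impI; (elim conjE)?)
  have swap: "(u, v) \<in> limiting_normal_cone soc_compl (x, y) \<longleftrightarrow>
      (v, u) \<in> limiting_normal_cone soc_compl (y, x)"
    "(u, v) \<in> regular_normal_cone soc_compl (x, y) \<longleftrightarrow>
      (v, u) \<in> regular_normal_cone soc_compl (y, x)" for u v
    by (rule limiting_normal_swap regular_normal_swap)+
  {
    assume "x = 0" "y \<in> interior soc"
    then show "limiting_normal_cone soc_compl (x, y) = {(u, v). v = 0}"
      "limiting_normal_cone soc_compl (x, y) = regular_normal_cone soc_compl (x, y)"
      using limiting_normal_apex_interior[of y] by simp_all
  next
    assume "x \<in> interior soc" "y = 0"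
    then have "limiting_normal_cone soc_compl (y, x) = {(u, v). v = 0}"
      "regular_normal_cone soc_compl (y, x) = {(u, v). v = 0}"
      using limiting_normal_apex_interior[of x] by simp_all
    then show "limiting_normal_cone soc_compl (x, y) = {(u, v). u = 0}"
      "limiting_normal_cone soc_compl (x, y) = regular_normal_cone soc_compl (x, y)"
      using swap by auto
  next
    assume "x \<in> frontier soc - {0}" "y \<in> frontier soc - {0}"
    then show "limiting_normal_cone soc_compl (x, y) =
          {(u, v). orthogonal u x \<and> orthogonal v y \<and>
                   coord1 x *\<^sub>R reflect u + coord1 y *\<^sub>R v \<in> line_of x}"
      "limiting_normal_cone soc_compl (x, y) = regular_normal_cone soc_compl (x, y)"
      using limiting_normal_smooth[OF assms] by simp_all
  next
    assume "x = 0" "y \<in> frontier soc - {0}"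
    then show "limiting_normal_cone soc_compl (x, y) =
          {(u, v). v = 0 \<or>
                   (orthogonal u (reflect y) \<and> v \<in> line_of (reflect y)) \<or>
                   (u \<bullet> reflect y \<le> 0 \<and> v \<in> neg_ray (reflect y))}"
      using limiting_normal_apex_frontier[of y] by simp
  next
    assume "x \<in> frontier soc - {0}" "y = 0"
    then show "limiting_normal_cone soc_compl (x, y) =
          {(u, v). u = 0 \<or>
                   (u \<in> line_of (reflect x) \<and> orthogonal v (reflect x)) \<or>
                   (u \<in> neg_ray (reflect x) \<and> v \<bullet> reflect x \<le> 0)}"
      using limiting_normal_apex_frontier[of x] swap(1) by auto
  next
    assume "x = 0" "y = 0"
    then show "limiting_normal_cone soc_compl (x, y) =
          {(u, v). (u \<in> uminus ` soc \<and> v \<in> uminus ` soc) \<or>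
                   v = 0 \<or>
                   u = 0 \<or>
                   (\<exists>\<xi>\<in>soc_directions. u \<in> neg_ray \<xi> \<and> v \<in> polar_of \<xi>) \<or>
                   (\<exists>\<xi>\<in>soc_directions. u \<in> polar_of \<xi> \<and> v \<in> neg_ray \<xi>) \<or>
                   (\<exists>\<alpha>\<in>{0..1}. \<exists>\<xi>\<in>soc_directions.
                      orthogonal u \<xi> \<and> orthogonal v (reflect \<xi>) \<and>
                      \<alpha> *\<^sub>R reflect u + (1 - \<alpha>) *\<^sub>R v \<in> line_of \<xi>)}"
      using limiting_normal_origin unfolding origin_normals_def by simp
  }
qed

end
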